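(* For every finitely generated group $G$ of exponential growth, the permutational wreath product $G\wr_X G_{012}$ has non-uniform exponential growth, where $G_{012}$ is the first Grigorchuk group and $X\subset\{0,1\}^\infty$ is the orbit of $0^\infty$ under $G_{012}$.
   Context: The first Grigorchuk group $G_{012}$ is the group of transformations of $\{0,1\}^\infty$ (acting on the right) generated by $a,b,c,d$, defined recursively for $\omega\in\{0,1\}^\infty$ by $(0\omega)a=1\omega$, $(1\omega)a=0\omega$; $(0\omega)b=0(\omega a)$, $(1\omega)b=1(\omega c)$; $(0\omega)c=0(\omega a)$, $(1\omega)c=1(\omega d)$; $(0\omega)d=0\omega$, $(1\omega)d=1(\omega b)$. For a group $A$ and a group $\Gamma$ acting on a set $X$, the permutational wreath product is $A\wr_X\Gamma=\{f:X\to A\text{ finitely supported}\}\rtimes\Gamma$, with $\Gamma$ acting on functions through its action on $X$. For a group $G$ generated by a finite set $S$, $\nu_{G,S}(R)$ is the number of elements of $G$ expressible as a product of at most $R$ elements of $S\cup S^{-1}$, and $\lambda_{G,S}=\lim_{R\to\infty}\sqrt[R]{\nu_{G,S}(R)}$. The group has exponential growth if $\lambda_{G,S}>1$ (for some, equivalently every, finite generating set $S$), and non-uniform exponential growth if moreover $\inf_S\lambda_{G,S}=1$, the infimum being over all finite generating sets $S$ of $G$. *)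

theory Defs
  imports Complex_Main "HOL-Algebra.Product_Groups" "HOL-Algebra.Group_Action" "HOL-Library.Stream"
begin

section \<open>Word growth\<close>

definition finite_generating_set :: "('a, 'b) monoid_scheme \<Rightarrow> 'a set \<Rightarrow> bool" where
  "finite_generating_set G S \<longleftrightarrow> finite S \<and> S \<subseteq> carrier G \<and> generate G S = carrier G"

definition finitely_generated :: "('a, 'b) monoid_scheme \<Rightarrow> bool" where
  "finitely_generated G \<longleftrightarrow> (\<exists>S. finite_generating_set G S)"

definition word_ball :: "('a, 'b) monoid_scheme \<Rightarrow> 'a set \<Rightarrow> nat \<Rightarrow> 'a set" where
  "word_ball G S R =
     {foldr (mult G) w \<one>\<^bsub>G\<^esub> | w. set w \<subseteq> S \<union> m_inv G ` S \<and> length w \<le> R}"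

definition growth_function :: "('a, 'b) monoid_scheme \<Rightarrow> 'a set \<Rightarrow> nat \<Rightarrow> nat" where
  "growth_function G S R = card (word_ball G S R)"

text \<open>For a finite set \<open>S\<close> in a group the limit exists, by submultiplicativity of the growth
  function.\<close>

definition growth_rate :: "('a, 'b) monoid_scheme \<Rightarrow> 'a set \<Rightarrow> real" where
  "growth_rate G S = lim (\<lambda>R. root R (real (growth_function G S R)))"

definition exponential_growth :: "('a, 'b) monoid_scheme \<Rightarrow> bool" where
  "exponential_growth G \<longleftrightarrow> (\<exists>S. finite_generating_set G S \<and> growth_rate G S > 1)"

definition nonuniform_exponential_growth :: "('a, 'b) monoid_scheme \<Rightarrow> bool" where
  "nonuniform_exponential_growth G \<longleftrightarrow>
     exponential_growth G \<and> (INF S\<in>{S. finite_generating_set G S}. growth_rate G S) = 1"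

section \<open>Permutational wreath products\<close>

text \<open>\<open>\<phi>\<close> is a left action of \<open>H\<close> on \<open>N\<close> by automorphisms.\<close>

definition semidirect_product ::
  "('n, 'b) monoid_scheme \<Rightarrow> ('h, 'c) monoid_scheme \<Rightarrow> ('h \<Rightarrow> 'n \<Rightarrow> 'n) \<Rightarrow> ('n \<times> 'h) monoid" where
  "semidirect_product N H \<phi> =
     \<lparr>carrier = carrier N \<times> carrier H,
      mult = (\<lambda>(n, h) (n', h'). (n \<otimes>\<^bsub>N\<^esub> \<phi> h n', h \<otimes>\<^bsub>H\<^esub> h')),
      one = (\<one>\<^bsub>N\<^esub>, \<one>\<^bsub>H\<^esub>)\<rparr>"

text \<open>A right action \<open>act x g\<close> of \<open>\<Gamma>\<close> on \<open>X\<close> turns into the left action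
  \<open>(g f)(x) = f (act x g)\<close> on functions on \<open>X\<close>. The group \<open>sum_group X (\<lambda>_. A)\<close> consists of the
  finitely supported functions \<open>X \<Rightarrow> A\<close>, represented as extensional functions on \<open>X\<close>.\<close>

definition perm_wreath_product ::
  "('a, 'b) monoid_scheme \<Rightarrow> 'x set \<Rightarrow> ('x \<Rightarrow> 'g \<Rightarrow> 'x) \<Rightarrow> ('g, 'c) monoid_scheme
     \<Rightarrow> (('x \<Rightarrow> 'a) \<times> 'g) monoid" where
  "perm_wreath_product A X act \<Gamma> =
     semidirect_product (sum_group X (\<lambda>_. A)) \<Gamma> (\<lambda>g f. \<lambda>x\<in>X. f (act x g))"

section \<open>The first Grigorchuk group\<close>

text \<open>Infinite binary sequences are streams of booleans, with \<open>False\<close> for \<open>0\<close> and \<open>True\<close>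
  for \<open>1\<close>.\<close>

definition grig_a :: "bool stream \<Rightarrow> bool stream" where
  "grig_a s = (\<not> shd s) ## stl s"

datatype bcd = Gen_b | Gen_c | Gen_d

fun next_bcd :: "bcd \<Rightarrow> bcd" where
  "next_bcd Gen_b = Gen_c"
| "next_bcd Gen_c = Gen_d"
| "next_bcd Gen_d = Gen_b"

text \<open>The mutual recursion defining \<open>b\<close>, \<open>c\<close>, \<open>d\<close> is carried out as a single corecursion with the
  name of the generator as a parameter; the original equations are derived below.\<close>

primcorec grig_bcd :: "bcd \<Rightarrow> bool stream \<Rightarrow> bool stream" where
  "grig_bcd q s = shd s ##
     (if shd s then grig_bcd (next_bcd q) (stl s)
      else if q = Gen_d then stl s else grig_a (stl s))"

definition "grig_b = grig_bcd Gen_b"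
definition "grig_c = grig_bcd Gen_c"
definition "grig_d = grig_bcd Gen_d"

lemma grig_recursion:
  "grig_a (False ## w) = True ## w"           "grig_a (True ## w) = False ## w"
  "grig_b (False ## w) = False ## grig_a w"   "grig_b (True ## w) = True ## grig_c w"
  "grig_c (False ## w) = False ## grig_a w"   "grig_c (True ## w) = True ## grig_d w"
  "grig_d (False ## w) = False ## w"          "grig_d (True ## w) = True ## grig_b w"
  by (simp_all add: grig_a_def grig_b_def grig_c_def grig_d_def grig_bcd.code[of _ "_ ## _"])

text \<open>Transformations act on the right, so a product \<open>g h\<close> applies \<open>g\<close> first.\<close>

definition right_sym_group :: "'x itself \<Rightarrow> ('x \<Rightarrow> 'x) monoid" where
  "right_sym_group _ = \<lparr>carrier = {g. bij g}, mult = (\<lambda>g h. h \<circ> g), one = id\<rparr>"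

definition grigorchuk_group :: "(bool stream \<Rightarrow> bool stream) monoid" where
  "grigorchuk_group =
     subgroup_generated (right_sym_group TYPE(bool stream)) {grig_a, grig_b, grig_c, grig_d}"

definition grigorchuk_orbit :: "bool stream set" where
  "grigorchuk_orbit = orbit grigorchuk_group (\<lambda>g. g) (sconst False)"

text \<open>\<^const>\<open>subgroup_generated\<close> discards generators outside the ambient group; none are lost here,
  since all four generators are involutions.\<close>

lemma grig_a_involution: "grig_a (grig_a s) = s"
  by (simp add: grig_a_def)

lemma grig_bcd_involution: "grig_bcd q (grig_bcd q s) = s"
proof -
  have "grig_bcd q (grig_bcd q s) !! n = s !! n" for n
    by (induction n arbitrary: q s) (auto simp: grig_a_involution)
  then show ?thesis
    using smap_alt[of id "grig_bcd q (grig_bcd q s)" s] by (simp add: stream.map_id)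
qed

lemma grig_generators_in_carrier:
  "{grig_a, grig_b, grig_c, grig_d} \<subseteq> carrier (right_sym_group TYPE(bool stream))"
proof -
  have "bij grig_a" "bij (grig_bcd q)" for q
    by (auto intro: involuntory_imp_bij simp: grig_a_involution grig_bcd_involution)
  then show ?thesis
    by (simp add: right_sym_group_def grig_b_def grig_c_def grig_d_def)
qed

end

theory Submission
  imports Defs
begin

text \<open>
  Put one lamp \<open>s\<close> for each generator \<open>s\<close> of \<open>G\<close> at a point \<open>p s\<close> of the orbit, with these points
  at mutual distance more than \<open>2R\<close> in the Schreier graph; together with \<open>a, b, c, d\<close> they generate
  the wreath product. In a word of length at most \<open>R\<close> lamps of different kinds never meet, so all
  values are powers \<open>s\<^sup>e\<close> with \<open>\<bar>e\<bar> \<le> R\<close>, and they sit on the inverted orbit of the base points under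
  the Grigorchuk part of the word. Words of the Grigorchuk group contract: the two sections of a word
  of weight \<open>n\<close> have total weight at most \<open>6/7 (n + 5)\<close>, and the inverted orbit of the word is covered
  by those of the sections. Hence the number \<open>C n\<close> of pairs (group element, configuration on its
  inverted orbit) satisfies \<open>C n \<le> 2 (\<Sum> C i * C j)\<close> over \<open>i + j \<le> 6/7 (n + 5)\<close>. Unfolding this \<open>m\<close>
  times for \<open>R = 4\<^sup>m\<close> gives \<open>ln (C (6R)) / R \<longlongrightarrow> 0\<close> even though the number of values grows
  linearly in \<open>R\<close>. Since the growth rate is at most the \<open>R\<close>-th root of the size of the \<open>R\<close>-ball, these
  generating sets have growth rates tending to \<open>1\<close>.
\<close>

section \<open>Sections and inverted orbits of words\<close>

text \<open>Words in \<open>a, b, c, d\<close> are lists over \<^typ>\<open>bcd option\<close>, with \<^const>\<open>None\<close> for \<open>a\<close>.\<close>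

fun letter_act :: "bcd option \<Rightarrow> bool stream \<Rightarrow> bool stream" where
  "letter_act None = grig_a"
| "letter_act (Some q) = grig_bcd q"

fun word_act :: "bcd option list \<Rightarrow> bool stream \<Rightarrow> bool stream" where
  "word_act [] = id"
| "word_act (s # w) = word_act w \<circ> letter_act s"

text \<open>The points \<open>z g\<inverse>\<close> for \<open>z \<in> Z\<close> and prefixes \<open>g\<close> of the word; the letters are involutions.\<close>

fun inv_orbit :: "bcd option list \<Rightarrow> bool stream set \<Rightarrow> bool stream set" where
  "inv_orbit [] Z = Z"
| "inv_orbit (s # w) Z = Z \<union> letter_act s ` inv_orbit w Z"

text \<open>For elements of the Klein group \<open>{1, b, c, d}\<close>, \<^const>\<open>None\<close> is the identity.\<close>

fun klein_act :: "bcd option \<Rightarrow> bool stream \<Rightarrow> bool stream" where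
  "klein_act None = id"
| "klein_act (Some q) = grig_bcd q"

text \<open>Of two distinct nontrivial elements one is the cyclic successor of the other, and their
  product is the successor of that one.\<close>

fun klein_mult :: "bcd \<Rightarrow> bcd option \<Rightarrow> bcd option" where
  "klein_mult q None = Some q"
| "klein_mult q (Some q') =
     (if q = q' then None else Some (if q = next_bcd q' then next_bcd q else next_bcd q'))"

text \<open>Any two of these weights sum to at least the third, and with weight 5 for \<open>a\<close> the sections of
  \<open>b = (a, c)\<close>, \<open>c = (a, d)\<close>, \<open>d = (1, b)\<close> have total weight at most \<open>6/7\<close> of that of \<open>ab\<close>, \<open>ac\<close>, \<open>ad\<close>.\<close>

fun bcd_weight :: "bcd \<Rightarrow> nat" where
  "bcd_weight Gen_b = 6"
| "bcd_weight Gen_c = 4"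
| "bcd_weight Gen_d = 2"

fun letter_weight :: "bcd option \<Rightarrow> nat" where
  "letter_weight None = 5"
| "letter_weight (Some q) = bcd_weight q"

fun klein_weight :: "bcd option \<Rightarrow> nat" where
  "klein_weight None = 0"
| "klein_weight (Some q) = bcd_weight q"

definition word_weight :: "bcd option list \<Rightarrow> nat" where
  "word_weight w = sum_list (map letter_weight w)"

lemma word_weight_simps [simp]:
  "word_weight [] = 0"
  "word_weight (s # w) = letter_weight s + word_weight w"
  "word_weight (u @ w) = word_weight u + word_weight w"
  by (simp_all add: word_weight_def)

text \<open>Sections are kept as words rather than transformations because weights and inverted
  orbits are attached to words. Here they have length at most one, so they are palindromes and act
  as involutions.\<close>

fun klein_section :: "bool \<Rightarrow> bcd option \<Rightarrow> bcd option list" where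
  "klein_section j None = []"
| "klein_section j (Some q) = (if j then [Some (next_bcd q)] else if q = Gen_d then [] else [None])"

section \<open>Action and sections of the Klein group\<close>

lemma word_act_append [simp]: "word_act (u @ w) = word_act w \<circ> word_act u"
  by (induction u) (auto simp: fun_eq_iff)

lemma grig_bcd_Cons [simp]:
  "grig_bcd q (False ## t) = False ## (if q = Gen_d then t else grig_a t)"
  "grig_bcd q (True ## t) = True ## grig_bcd (next_bcd q) t"
  by (simp_all add: grig_bcd.code[of _ "_ ## _"])

lemma grig_a_Cons [simp]: "grig_a (j ## t) = (\<not> j) ## t"
  by (simp add: grig_a_def)

lemma klein_act_Cons: "klein_act v (j ## t) = j ## word_act (klein_section j v) t"
  by (cases v; cases j) auto

lemma next_bcd_inject [simp]: "next_bcd q = next_bcd q' \<longleftrightarrow> q = q'"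
  by (cases q; cases q') auto

text \<open>The cyclic relabelling is an automorphism of the Klein group; it carries the
  multiplication law to the section at 1.\<close>

lemma klein_mult_next:
  "map_option next_bcd (klein_mult q v) = klein_mult (next_bcd q) (map_option next_bcd v)"
  by (cases v) auto

text \<open>Compare the images letter by letter. On the branch 1 this is the same claim for the
  relabelled elements one level down; on the branch 0 only \<open>a\<close> and the identity occur,
  and it reduces to \<open>a\<close> being an involution.\<close>

lemma klein_act_mult: "klein_act (klein_mult q v) s = grig_bcd q (klein_act v s)"
proof -
  have "klein_act (klein_mult q v) s !! n = grig_bcd q (klein_act v s) !! n" for n
  proof (induction n arbitrary: q v s)
    case 0
    then show ?case
      by (cases v) auto
  next
    case (Suc n)
    show ?case
    proof (cases "shd s")
      case True
      then have s: "s = True ## stl s"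
        by (metis stream.collapse)
      have "klein_act v (True ## t) = True ## klein_act (map_option next_bcd v) t" for v t
        by (cases v) auto
      then have "klein_act v s = True ## klein_act (map_option next_bcd v) (stl s)" for v
        using s by metis
      then show ?thesis
        using Suc by (simp add: klein_mult_next)
    next
      case False
      then have s: "s = False ## stl s"
        by (metis stream.collapse)
      show ?thesis
      proof (cases v)
        case None
        then show ?thesis
          by simp
      next
        case (Some q')
        have "klein_act (klein_mult q v) (False ## t) = grig_bcd q (klein_act v (False ## t))" for t
          using Some by (cases q; cases q') (auto simp: grig_a_involution)
        then show ?thesis
          using s by metis
      qed
    qed
  qed
  then show ?thesis
    using smap_alt[of id "klein_act (klein_mult q v) s"] by (simp add: stream.map_id)
qed

lemma klein_weight_mult: "klein_weight (klein_mult q v) \<le> bcd_weight q + klein_weight v"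
  by (cases v; cases q; cases "the v") auto

text \<open>The 5 is the weight of a letter \<open>a\<close> next to the block \<open>v\<close>. The
  nontrivial cases read 63 <= 66, 49 <= 54 and 42 <= 42, so the ratio 6/7 is attained at
  \<open>d\<close>.\<close>

lemma klein_section_weight:
  "7 * (word_weight (klein_section False v) + word_weight (klein_section True v))
     \<le> 6 * (5 + klein_weight v)"
  by (cases v; cases "the v") auto

lemma inv_orbit_mono: "Z \<subseteq> Z' \<Longrightarrow> inv_orbit w Z \<subseteq> inv_orbit w Z'"
  by (induction w) auto

lemma subset_inv_orbit: "Z \<subseteq> inv_orbit w Z"
  by (cases w) auto

text \<open>Prepending \<open>u\<close> multiplies the prefixes of \<open>w\<close> by
  \<open>u\<close> on the left, so the points move by the inverse of \<open>u\<close>, which is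
  \<open>rev u\<close> as the letters are involutions.\<close>

lemma inv_orbit_append_act:
  assumes "t \<in> inv_orbit w Z"
  shows "word_act (rev u) t \<in> inv_orbit (u @ w) Z"
  using assms by (induction u) auto

lemma klein_act_involution: "klein_act v (klein_act v s) = s"
  by (cases v) (auto simp: grig_bcd_involution)

lemma rev_klein_section [simp]: "rev (klein_section j v) = klein_section j v"
  by (cases v) auto

lemma klein_act_inv_orbit:
  "klein_act v ` (\<Union>j. (##) j ` inv_orbit (u j) Z)
     \<subseteq> (\<Union>j. (##) j ` inv_orbit (klein_section j v @ u j) Z)"
proof
  fix x assume "x \<in> klein_act v ` (\<Union>j. (##) j ` inv_orbit (u j) Z)"
  then obtain j t where "t \<in> inv_orbit (u j) Z" "x = j ## word_act (klein_section j v) t"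
    by (auto simp: klein_act_Cons)
  then show "x \<in> (\<Union>j. (##) j ` inv_orbit (klein_section j v @ u j) Z)"
    using inv_orbit_append_act[of t "u j" Z "klein_section j v"] by auto
qed

section \<open>Splitting a word into its two sections\<close>

text \<open>Encodes \<open>w = v r\<close> with \<open>v\<close> in the Klein group and \<open>r\<close> empty or starting with \<open>a\<close>; \<open>u\<close> gives the
  sections of \<open>r\<close>. A cancelled block such as \<open>bb\<close> in \<open>abba\<close> is kept as a trivial syllable, since
  deleting \<open>aa\<close> would lose points of the inverted orbit.\<close>

definition decomposition ::
  "bcd option list \<Rightarrow> bcd option \<Rightarrow> (bool \<Rightarrow> bcd option list) \<Rightarrow> bool \<Rightarrow> bool" where
  "decomposition w v u e \<longleftrightarrow>
     7 * (word_weight (u False) + word_weight (u True)) + 6 * klein_weight v \<le> 6 * word_weight w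
     \<and> (\<forall>j t. word_act w (klein_act v (j ## t)) = (j \<noteq> e) ## word_act (u j) t)
     \<and> (\<forall>Z B. (\<forall>v. klein_act v ` Z \<subseteq> Z) \<longrightarrow> Z \<subseteq> (\<Union>j. (##) j ` B) \<longrightarrow>
          inv_orbit w Z \<subseteq> klein_act v ` (\<Union>j. (##) j ` inv_orbit (u j) B))"

lemma decompositionI:
  assumes "7 * (word_weight (u False) + word_weight (u True)) + 6 * klein_weight v \<le> 6 * word_weight w"
    and "\<And>j t. word_act w (klein_act v (j ## t)) = (j \<noteq> e) ## word_act (u j) t"
    and "\<And>Z B. (\<And>v. klein_act v ` Z \<subseteq> Z) \<Longrightarrow> Z \<subseteq> (\<Union>j. (##) j ` B) \<Longrightarrow>
          inv_orbit w Z \<subseteq> klein_act v ` (\<Union>j. (##) j ` inv_orbit (u j) B)"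
  shows "decomposition w v u e"
  unfolding decomposition_def by (intro conjI allI impI; rule assms; simp)

lemma decompositionD:
  assumes "decomposition w v u e"
  shows "7 * (word_weight (u False) + word_weight (u True)) + 6 * klein_weight v \<le> 6 * word_weight w"
    and "word_act w (klein_act v (j ## t)) = (j \<noteq> e) ## word_act (u j) t"
    and "(\<And>v. klein_act v ` Z \<subseteq> Z) \<Longrightarrow> Z \<subseteq> (\<Union>j. (##) j ` B) \<Longrightarrow>
          inv_orbit w Z \<subseteq> klein_act v ` (\<Union>j. (##) j ` inv_orbit (u j) B)"
proof -
  show "7 * (word_weight (u False) + word_weight (u True)) + 6 * klein_weight v \<le> 6 * word_weight w"
    using assms unfolding decomposition_def by (rule conjunct1)
  show "word_act w (klein_act v (j ## t)) = (j \<noteq> e) ## word_act (u j) t"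
    using assms unfolding decomposition_def by simp
  show "inv_orbit w Z \<subseteq> klein_act v ` (\<Union>j. (##) j ` inv_orbit (u j) B)"
    if Z: "\<And>v. klein_act v ` Z \<subseteq> Z" and B: "Z \<subseteq> (\<Union>j. (##) j ` B)"
    using assms unfolding decomposition_def by (elim conjE allE) (iprover intro: Z B)
qed

text \<open>Read the word from the right. A letter \<open>b\<close>, \<open>c\<close> or
  \<open>d\<close> is absorbed into the pending Klein element \<open>v\<close>; a letter
  \<open>a\<close> pays with its weight 5 for replacing \<open>v\<close> by its sections and
  exchanges the two coordinates.\<close>

lemma decomposition_exists: "\<exists>v u e. decomposition w v u e"
proof (induction w)
  case Nil
  have "decomposition [] None (\<lambda>_. []) False"
    by (rule decompositionI) simp_all
  then show ?case
    by blast
next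
  case (Cons s w)
  then obtain v u e where w: "decomposition w v u e"
    by blast
  note weight = decompositionD(1)[OF w] and act = decompositionD(2)[OF w]
    and orb = decompositionD(3)[OF w]
  show ?case
  proof (cases s)
    case None
    \<comment> \<open>As \<open>a\<close> exchanges the subtrees, the section at \<open>j\<close> is
      the former one at \<open>\<not> j\<close>, preceded by the section of the pending
      \<open>v\<close>.\<close>
    define u' where "u' j = klein_section (\<not> j) v @ u (\<not> j)" for j
    have "decomposition (s # w) None u' (\<not> e)"
    proof (rule decompositionI)
      show "7 * (word_weight (u' False) + word_weight (u' True)) + 6 * klein_weight None
              \<le> 6 * word_weight (s # w)"
        using weight klein_section_weight[of v] None by (simp add: u'_def)
    next
      fix j t
      \<comment> \<open>Evaluate \<open>act\<close> at a point already moved by \<open>v\<close>: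
        the two copies of \<open>v\<close> cancel.\<close>
      have "word_act w (k ## t) = (k \<noteq> e) ## word_act (klein_section k v @ u k) t" for k
        using act[of k "word_act (klein_section k v) t"]
        by (metis klein_act_Cons klein_act_involution word_act_append comp_apply)
      then show "word_act (s # w) (klein_act None (j ## t)) = (j \<noteq> (\<not> e)) ## word_act (u' j) t"
        using None by (auto simp: u'_def)
    next
      fix Z B
      assume Z: "\<And>v. klein_act v ` Z \<subseteq> Z" and B: "Z \<subseteq> (\<Union>j. (##) j ` B)"
      have "inv_orbit w Z \<subseteq> (\<Union>j. (##) j ` inv_orbit (u' (\<not> j)) B)"
        using orb[OF Z B] klein_act_inv_orbit[of v u B] by (simp add: u'_def)
      then have "grig_a ` inv_orbit w Z \<subseteq> grig_a ` (\<Union>j. (##) j ` inv_orbit (u' (\<not> j)) B)"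
        by (rule image_mono)
      also have "\<dots> \<subseteq> (\<Union>j. (##) j ` inv_orbit (u' j) B)"
      proof
        fix x assume "x \<in> grig_a ` (\<Union>j. (##) j ` inv_orbit (u' (\<not> j)) B)"
        then obtain j t where "t \<in> inv_orbit (u' (\<not> j)) B" "x = (\<not> j) ## t"
          by auto
        then show "x \<in> (\<Union>j. (##) j ` inv_orbit (u' j) B)"
          by blast
      qed
      finally have "grig_a ` inv_orbit w Z \<subseteq> (\<Union>j. (##) j ` inv_orbit (u' j) B)" .
      moreover have "Z \<subseteq> (\<Union>j. (##) j ` inv_orbit (u' j) B)"
        by (rule order_trans[OF B]) (intro UN_mono order_refl image_mono subset_inv_orbit)
      ultimately show "inv_orbit (s # w) Z \<subseteq> klein_act None ` (\<Union>j. (##) j ` inv_orbit (u' j) B)"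
        using None by simp
    qed
    then show ?thesis
      by blast
  next
    case (Some q)
    define v' where "v' = klein_mult q v"
    have v': "klein_act v' t = grig_bcd q (klein_act v t)" for t
      by (simp add: v'_def klein_act_mult)
    have "decomposition (s # w) v' u e"
    proof (rule decompositionI)
      show "7 * (word_weight (u False) + word_weight (u True)) + 6 * klein_weight v'
              \<le> 6 * word_weight (s # w)"
        using weight klein_weight_mult[of q v] Some by (simp add: v'_def)
    next
      show "word_act (s # w) (klein_act v' (j ## t)) = (j \<noteq> e) ## word_act (u j) t" for j t
        using act[of j t] Some v' by (simp add: grig_bcd_involution)
    next
      fix Z B
      assume Z: "\<And>v. klein_act v ` Z \<subseteq> Z" and B: "Z \<subseteq> (\<Union>j. (##) j ` B)"
      have "grig_bcd q ` inv_orbit w Z \<subseteq> grig_bcd q ` klein_act v ` (\<Union>j. (##) j ` inv_orbit (u j) B)"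
        using orb[OF Z B] by (rule image_mono)
      also have "\<dots> = klein_act v' ` (\<Union>j. (##) j ` inv_orbit (u j) B)"
        unfolding image_image v' by (rule refl)
      finally have "grig_bcd q ` inv_orbit w Z \<subseteq> klein_act v' ` (\<Union>j. (##) j ` inv_orbit (u j) B)" .
      \<comment> \<open>By Klein invariance \<open>v'\<close> maps \<open>z\<close> into
        \<open>Z\<close>, and applying the involution \<open>v'\<close> once more returns
        \<open>z\<close>.\<close>
      moreover have "Z \<subseteq> klein_act v' ` (\<Union>j. (##) j ` inv_orbit (u j) B)"
      proof
        fix z assume "z \<in> Z"
        then have "klein_act v' z \<in> Z"
          using Z[of v'] by blast
        also note B
        also have "(\<Union>j. (##) j ` B) \<subseteq> (\<Union>j. (##) j ` inv_orbit (u j) B)"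
          by (intro UN_mono order_refl image_mono subset_inv_orbit)
        finally have "klein_act v' (klein_act v' z) \<in> klein_act v' ` (\<Union>j. (##) j ` inv_orbit (u j) B)"
          by (rule imageI)
        then show "z \<in> klein_act v' ` (\<Union>j. (##) j ` inv_orbit (u j) B)"
          by (simp only: klein_act_involution)
      qed
      ultimately show "inv_orbit (s # w) Z \<subseteq> klein_act v' ` (\<Union>j. (##) j ` inv_orbit (u j) B)"
        using Some by simp
    qed
    then show ?thesis
      by blast
  qed
qed

text \<open>Merging a block of letters \<open>b, c, d\<close> loses the points visited inside the block. They are recovered
  by enlarging the base set to \<open>Y {1, a, b, c, d}\<close>, a shape that is reproduced at the next level.\<close>

definition thicken :: "bool stream set \<Rightarrow> bool stream set" where
  "thicken Y = Y \<union> (\<Union>s. letter_act s ` Y)"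

text \<open>The Klein element left at the front of the decomposition is pushed into the sections as
  well. No \<open>a\<close> is available to pay for it, which costs the additive 5.\<close>

lemma word_decomposition:
  "\<exists>u e. 7 * (word_weight (u False) + word_weight (u True)) \<le> 6 * (word_weight w + 5)
     \<and> (\<forall>j t. word_act w (j ## t) = (j \<noteq> e) ## word_act (u j) t)
     \<and> (\<forall>Y. inv_orbit w (thicken Y) \<subseteq> (\<Union>j. (##) j ` inv_orbit (u j) (thicken (stl ` Y))))"
proof -
  obtain v u e where w: "decomposition w v u e"
    using decomposition_exists by blast
  note weight = decompositionD(1)[OF w] and act = decompositionD(2)[OF w]
    and orb = decompositionD(3)[OF w]
  define u' where "u' j = klein_section j v @ u j" for j
  have "7 * (word_weight (u' False) + word_weight (u' True)) \<le> 6 * (word_weight w + 5)"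
    using weight klein_section_weight[of v] by (simp add: u'_def)
  moreover have "word_act w (j ## t) = (j \<noteq> e) ## word_act (u' j) t" for j t
    using act[of j "word_act (klein_section j v) t"] unfolding u'_def
    by (metis klein_act_Cons klein_act_involution word_act_append comp_apply)
  moreover have "inv_orbit w (thicken Y) \<subseteq> (\<Union>j. (##) j ` inv_orbit (u' j) (thicken (stl ` Y)))" for Y
  proof -
    \<comment> \<open>The Klein closure provides the invariance required by \<open>orb\<close>. Its
      points arise from \<open>Y\<close> by at most one \<open>a\<close> followed by one Klein
      element, which acts on the tail by at most one letter; hence the tails lie in a thickening
      again.\<close>
    define Z where "Z = (\<Union>v. klein_act v ` thicken Y)"
    have closed: "klein_act v ` Z \<subseteq> Z" for v
    proof (cases v)
      case (Some q)
      have "klein_act v (klein_act v' t) = klein_act (klein_mult q v') t" for v' t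
        using Some by (simp add: klein_act_mult)
      then show ?thesis
        unfolding Z_def by blast
    qed simp
    have section_in: "word_act (klein_section j v) t \<in> thicken (stl ` Y)" if "i ## t \<in> Y" for i j v t
    proof -
      have t: "t \<in> stl ` Y"
        using that by (rule rev_image_eqI) simp
      then have "letter_act s t \<in> thicken (stl ` Y)" "t \<in> thicken (stl ` Y)" for s
        unfolding thicken_def by blast+
      from this(1)[of None] this(1)[of "Some (next_bcd (the v))"] this(2) show ?thesis
        by (cases v) simp_all
    qed
    \<comment> \<open>The first letter \<open>i\<close> is independent of \<open>k\<close> because
      the point of \<open>Y\<close> may have been moved by \<open>a\<close>, which leaves its tail
      unchanged.\<close>
    have section_in': "klein_act v (i ## t) \<in> (\<Union>j. (##) j ` thicken (stl ` Y))"
      if "k ## t \<in> Y" for i k v t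
      using section_in[OF that] unfolding klein_act_Cons by blast
    have "Z \<subseteq> (\<Union>j. (##) j ` thicken (stl ` Y))"
    proof
      fix z assume "z \<in> Z"
      then obtain v y where v: "z = klein_act v y" and y: "y \<in> thicken Y"
        unfolding Z_def by blast
      show "z \<in> (\<Union>j. (##) j ` thicken (stl ` Y))"
      proof (cases "y \<in> Y")
        case True
        then show ?thesis
          using section_in'[of "shd y" "stl y" v "shd y"] v by simp
      next
        case False
        then obtain s x where x: "x \<in> Y" "y = letter_act s x"
          using y unfolding thicken_def by blast
        show ?thesis
        proof (cases s)
          case None
          then show ?thesis
            using section_in'[of "shd x" "stl x" v "\<not> shd x"] v x by (simp add: grig_a_def)
        next
          case (Some q)
          have "\<exists>v'. z = klein_act v' x"
          proof (cases v)
            case None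
            then show ?thesis
              using v x Some by (intro exI[of _ "Some q"]) simp
          next
            case v_Some: (Some q')
            then show ?thesis
              using v x Some by (intro exI[of _ "klein_mult q' (Some q)"], subst klein_act_mult) simp
          qed
          then obtain v' where "z = klein_act v' x"
            by blast
          then show ?thesis
            using section_in'[of "shd x" "stl x" v' "shd x"] x by simp
        qed
      qed
    qed
    from orb[OF closed this] have "inv_orbit w Z \<subseteq> (\<Union>j. (##) j ` inv_orbit (u' j) (thicken (stl ` Y)))"
      using klein_act_inv_orbit[of v u] unfolding u'_def by (rule order_trans)
    moreover have "thicken Y \<subseteq> Z"
    proof -
      have "klein_act None ` thicken Y \<subseteq> Z"
        unfolding Z_def by blast
      then show ?thesis
        by simp
    qed
    ultimately show ?thesis
      using inv_orbit_mono[of "thicken Y" Z w] by simp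
  qed
  ultimately show ?thesis
    by (intro exI[of _ u'] exI[of _ e] conjI allI)
qed

section \<open>Counting configurations on inverted orbits\<close>

text \<open>The word is existential: a transformation is paired with the configurations allowed by
  any of its words of weight at most \<open>n\<close>. Values on the inverted orbit are arbitrary in
  \<open>Q\<close>, so the lamp group disappears from the count and a configuration can be cut
  freely along the two subtrees.\<close>

definition configs ::
  "'v \<Rightarrow> 'v set \<Rightarrow> bool stream set \<Rightarrow> nat \<Rightarrow> ((bool stream \<Rightarrow> bool stream) \<times> (bool stream \<Rightarrow> 'v)) set" where
  "configs z Q Y n = {(g, f). \<exists>w. word_weight w \<le> n \<and> g = word_act w \<and> range f \<subseteq> Q
     \<and> (\<forall>x. x \<notin> inv_orbit w (thicken Y) \<longrightarrow> f x = z)}"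

section \<open>A crude bound for the number of configurations\<close>

lemma UNIV_bcd: "(UNIV :: bcd set) = {Gen_b, Gen_c, Gen_d}"
proof -
  have "q \<in> {Gen_b, Gen_c, Gen_d}" for q
    by (cases q) auto
  then show ?thesis
    by auto
qed

lemma finite_UNIV_bcd [simp]: "finite (UNIV :: bcd set)"
  by (simp add: UNIV_bcd)

lemma card_UNIV_letter: "card (UNIV :: bcd option set) = 4"
  by (simp add: UNIV_option_conv card_image UNIV_bcd)

lemma finite_thicken [simp]: "finite Y \<Longrightarrow> finite (thicken Y)"
  by (simp add: thicken_def)

lemma card_thicken_le:
  assumes "finite Y"
  shows "card (thicken Y) \<le> 5 * card Y"
proof -
  have "card (thicken Y) \<le> card Y + card (\<Union>s. letter_act s ` Y)"
    unfolding thicken_def by (rule card_Un_le)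
  also have "card (\<Union>s. letter_act s ` Y) \<le> (\<Sum>s\<in>UNIV. card (letter_act s ` Y))"
    by (rule card_UN_le) simp
  also have "\<dots> \<le> (\<Sum>s\<in>(UNIV :: bcd option set). card Y)"
    by (intro sum_mono card_image_le assms)
  finally show ?thesis
    by (simp add: card_UNIV_letter)
qed

lemma finite_inv_orbit [simp]: "finite Z \<Longrightarrow> finite (inv_orbit w Z)"
  by (induction w) auto

lemma card_inv_orbit_le:
  assumes "finite Z"
  shows "card (inv_orbit w Z) \<le> (length w + 1) * card Z"
proof (induction w)
  case (Cons s w)
  have "card (inv_orbit (s # w) Z) \<le> card Z + card (letter_act s ` inv_orbit w Z)"
    using card_Un_le by auto
  also have "card (letter_act s ` inv_orbit w Z) \<le> card (inv_orbit w Z)"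
    using assms by (intro card_image_le) simp
  finally show ?case
    using Cons by simp
qed simp

lemma length_le_word_weight: "length w \<le> word_weight w"
proof (induction w)
  case (Cons s w)
  have "1 \<le> letter_weight s"
    by (cases s; cases "the s") auto
  with Cons show ?case
    by simp
qed simp

lemma finite_card_functions_le:
  assumes "finite A" "finite Q"
  shows "finite {f. range f \<subseteq> Q \<and> (\<forall>x. x \<notin> A \<longrightarrow> f x = z)}" (is "finite ?F")
    and "card {f. range f \<subseteq> Q \<and> (\<forall>x. x \<notin> A \<longrightarrow> f x = z)} \<le> card Q ^ card A"
proof -
  have inj: "inj_on (\<lambda>f. restrict f A) ?F"
  proof (rule inj_onI, rule ext)
    fix f g x
    assume fg: "f \<in> ?F" "g \<in> ?F" and eq: "restrict f A = restrict g A"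
    show "f x = g x"
    proof (cases "x \<in> A")
      case True
      then show ?thesis
        using fun_cong[OF eq, of x] by simp
    next
      case False
      then show ?thesis
        using fg by simp
    qed
  qed
  have sub: "(\<lambda>f. restrict f A) ` ?F \<subseteq> A \<rightarrow>\<^sub>E Q"
    by auto
  have fin: "finite (A \<rightarrow>\<^sub>E Q)"
    using assms by (intro finite_PiE) auto
  show "finite ?F"
    using finite_imageD[OF finite_subset[OF sub fin] inj] .
  show "card ?F \<le> card Q ^ card A"
    using card_inj_on_le[OF inj sub fin] card_PiE[OF assms(1), of "\<lambda>_. Q"] by simp
qed

lemma sum_powers_4_le: "(\<Sum>i\<le>n. 4 ^ i) \<le> (4::nat) ^ Suc n"
  by (induction n) auto

text \<open>This bounds the leaves of the recursion. Length is at most weight, so at most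
  \<open>4 ^ Suc n\<close> words occur, and \<open>Suc n\<close> prefixes times \<open>5 * k\<close>
  base points bound each inverted orbit.\<close>

lemma configs_trivial_bound:
  assumes "finite Y" "card Y \<le> k" "finite Q" "Q \<noteq> {}"
  shows "finite (configs z Q Y n)" and "card (configs z Q Y n) \<le> (4 * card Q ^ (5 * k)) ^ Suc n"
proof -
  define W where "W = {w :: bcd option list. set w \<subseteq> UNIV \<and> length w \<le> n}"
  define F where "F w = {f. range f \<subseteq> Q \<and> (\<forall>x. x \<notin> inv_orbit w (thicken Y) \<longrightarrow> f x = z)}" for w
  have W: "finite W" "card W \<le> 4 ^ Suc n"
    using finite_lists_length_le[of "UNIV :: bcd option set" n]
      card_lists_length_le[of "UNIV :: bcd option set" n] sum_powers_4_le[of n]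
    by (simp_all add: W_def card_UNIV_letter)
  have F: "finite (F w)" "card (F w) \<le> card Q ^ (5 * k * Suc n)" if "w \<in> W" for w
  proof -
    have fin: "finite (inv_orbit w (thicken Y))"
      using assms by simp
    show "finite (F w)"
      unfolding F_def by (rule finite_card_functions_le(1)[OF fin assms(3)])
    have "card (inv_orbit w (thicken Y)) \<le> (length w + 1) * card (thicken Y)"
      using assms by (intro card_inv_orbit_le) simp
    also have "\<dots> \<le> Suc n * (5 * k)"
      using that card_thicken_le[OF assms(1)] assms(2) unfolding W_def by (intro mult_mono) auto
    finally have "card Q ^ card (inv_orbit w (thicken Y)) \<le> card Q ^ (5 * k * Suc n)"
      using assms by (intro power_increasing) (auto simp: Suc_le_eq card_gt_0_iff mult.commute)
    then show "card (F w) \<le> card Q ^ (5 * k * Suc n)"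
      using finite_card_functions_le(2)[OF fin assms(3)] unfolding F_def by (rule le_trans[rotated])
  qed
  have sub: "configs z Q Y n \<subseteq> (\<Union>w\<in>W. Pair (word_act w) ` F w)"
  proof
    fix c assume "c \<in> configs z Q Y n"
    then obtain w f where "word_weight w \<le> n" "c = (word_act w, f)" "f \<in> F w"
      unfolding configs_def F_def by blast
    moreover from this have "w \<in> W"
      using length_le_word_weight[of w] by (simp add: W_def)
    ultimately show "c \<in> (\<Union>w\<in>W. Pair (word_act w) ` F w)"
      by blast
  qed
  have fin: "finite (\<Union>w\<in>W. Pair (word_act w) ` F w)"
    using W F by blast
  show "finite (configs z Q Y n)"
    using finite_subset[OF sub fin] .
  have "card (configs z Q Y n) \<le> card (\<Union>w\<in>W. Pair (word_act w) ` F w)"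
    using card_mono[OF fin sub] .
  also have "\<dots> \<le> (\<Sum>w\<in>W. card (Pair (word_act w) ` F w))"
    by (rule card_UN_le[OF W(1)])
  also have "\<dots> \<le> (\<Sum>w\<in>W. card Q ^ (5 * k * Suc n))"
    using F by (intro sum_mono) (meson card_image_le le_trans)
  also have "\<dots> \<le> 4 ^ Suc n * card Q ^ (5 * k * Suc n)"
    using W(2) by simp
  also have "\<dots> = (4 * card Q ^ (5 * k)) ^ Suc n"
    by (simp only: power_mult_distrib power_mult)
  finally show "card (configs z Q Y n) \<le> (4 * card Q ^ (5 * k)) ^ Suc n" .
qed

section \<open>The recursion and its unfolding\<close>

definition split_pairs :: "nat \<Rightarrow> (nat \<times> nat) set" where
  "split_pairs n = {(i, j). 7 * (i + j) \<le> 6 * (n + 5)}"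

text \<open>The number 30 is the fixed point of n -> 6/7 (n + 5), so for \<open>N\<close> at least
  30 the section weights stay below \<open>N\<close>.\<close>

lemma split_pairs_subset:
  assumes "n \<le> N" "30 \<le> N"
  shows "split_pairs n \<subseteq> {..N} \<times> {..N}"
  using assms by (auto simp: split_pairs_def)

lemma finite_split_pairs [simp]: "finite (split_pairs n)"
  using finite_subset[OF split_pairs_subset[of n "max n 30"]] by simp

text \<open>A pair is encoded by a swap bit, giving the factor 2, and by the two sections of
  \<open>g\<close>, each with the restriction of \<open>f\<close> to its subtree. By
  \<open>word_decomposition\<close> both are configurations over the tails of
  \<open>Y\<close>.\<close>

lemma configs_recursion:
  fixes z :: 'v
  assumes "finite Y" "finite Q" "Q \<noteq> {}"
  shows "card (configs z Q Y n)
    \<le> 2 * (\<Sum>(i, j)\<in>split_pairs n. card (configs z Q (stl ` Y) i) * card (configs z Q (stl ` Y) j))"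
proof -
  let ?C = "configs z Q (stl ` Y)"
  define T where "T = (UNIV :: bool set) \<times> (\<Union>(i, j)\<in>split_pairs n. ?C i \<times> ?C j)"
  \<comment> \<open>The bit, which is \<open>\<not> e\<close>, and the sections are read off from
    the values of \<open>g\<close> rather than from a word, so they depend on the pair
    alone.\<close>
  define \<Phi> :: "(bool stream \<Rightarrow> bool stream) \<times> (bool stream \<Rightarrow> 'v) \<Rightarrow> _" where
    "\<Phi> = (\<lambda>(g, f). let s = (\<lambda>j. (\<lambda>t. stl (g (j ## t)), \<lambda>t. f (j ## t)))
       in (shd (g (True ## sconst False)), s False, s True))"
  have fin: "finite (?C i)" for i
    using assms by (intro configs_trivial_bound(1)[OF _ order_refl]) auto
  have split: "\<exists>u e. 7 * (word_weight (u False) + word_weight (u True)) \<le> 6 * (n + 5)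
      \<and> (\<forall>j t. g (j ## t) = (j \<noteq> e) ## word_act (u j) t)
      \<and> (\<forall>j. (word_act (u j), \<lambda>t. f (j ## t)) \<in> ?C (word_weight (u j)))"
    if gf: "(g, f) \<in> configs z Q Y n" for g f
  proof -
    obtain w where w: "word_weight w \<le> n" "g = word_act w" "range f \<subseteq> Q"
        "\<And>x. x \<notin> inv_orbit w (thicken Y) \<Longrightarrow> f x = z"
      using gf unfolding configs_def by blast
    obtain u e where u: "7 * (word_weight (u False) + word_weight (u True)) \<le> 6 * (word_weight w + 5)"
      "\<forall>j t. word_act w (j ## t) = (j \<noteq> e) ## word_act (u j) t"
      "\<forall>Y. inv_orbit w (thicken Y) \<subseteq> (\<Union>j. (##) j ` inv_orbit (u j) (thicken (stl ` Y)))"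
      using word_decomposition[of w] by blast
    have "(word_act (u j), \<lambda>t. f (j ## t)) \<in> ?C (word_weight (u j))" for j
    proof -
      have "f (j ## t) = z" if t: "t \<notin> inv_orbit (u j) (thicken (stl ` Y))" for t
      proof (rule w(4))
        have "j ## t \<notin> (\<Union>j. (##) j ` inv_orbit (u j) (thicken (stl ` Y)))"
          using t by auto
        then show "j ## t \<notin> inv_orbit w (thicken Y)"
          using u(3) by (meson subsetD)
      qed
      moreover have "range (\<lambda>t. f (j ## t)) \<subseteq> Q"
        using w(3) by auto
      ultimately show ?thesis
        unfolding configs_def by blast
    qed
    moreover have "7 * (word_weight (u False) + word_weight (u True)) \<le> 6 * (n + 5)"
      by (rule le_trans[OF u(1)]) (simp add: w(1))
    ultimately show ?thesis
      unfolding w(2) using u(2) by (intro exI[of _ u] exI[of _ e] conjI) simp_all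
  qed
  have "\<Phi> ` configs z Q Y n \<subseteq> T"
  proof
    fix y assume "y \<in> \<Phi> ` configs z Q Y n"
    then obtain g f where gf: "(g, f) \<in> configs z Q Y n" "y = \<Phi> (g, f)"
      by auto
    then obtain u e where u: "7 * (word_weight (u False) + word_weight (u True)) \<le> 6 * (n + 5)"
      "\<forall>j t. g (j ## t) = (j \<noteq> e) ## word_act (u j) t"
      "\<forall>j. (word_act (u j), \<lambda>t. f (j ## t)) \<in> ?C (word_weight (u j))"
      using split[OF gf(1)] by blast
    have "(\<lambda>t. stl (g (j ## t))) = word_act (u j)" for j
      by (simp add: u(2))
    then have "y = (\<not> e, (word_act (u False), \<lambda>t. f (False ## t)), (word_act (u True), \<lambda>t. f (True ## t)))"
      unfolding gf(2) \<Phi>_def using u(2) by (simp add: Let_def)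
    moreover have "(word_weight (u False), word_weight (u True)) \<in> split_pairs n"
      using u(1) by (simp add: split_pairs_def)
    ultimately show "y \<in> T"
      using u(3) unfolding T_def by auto
  qed
  moreover have "inj_on \<Phi> (configs z Q Y n)"
  proof (rule inj_onI)
    fix c c' assume c: "c \<in> configs z Q Y n" "c' \<in> configs z Q Y n" and eq: "\<Phi> c = \<Phi> c'"
    obtain g f g' f' where gf: "c = (g, f)" "c' = (g', f')"
      by (meson surj_pair)
    obtain u e where u: "\<forall>j t. g (j ## t) = (j \<noteq> e) ## word_act (u j) t"
      using split[OF c(1)[unfolded gf]] by blast
    obtain u' e' where u': "\<forall>j t. g' (j ## t) = (j \<noteq> e') ## word_act (u' j) t"
      using split[OF c(2)[unfolded gf]] by blast
    have eqs: "shd (g (True ## sconst False)) = shd (g' (True ## sconst False))"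
      "(\<lambda>t. stl (g (False ## t))) = (\<lambda>t. stl (g' (False ## t)))"
      "(\<lambda>t. stl (g (True ## t))) = (\<lambda>t. stl (g' (True ## t)))"
      "(\<lambda>t. f (False ## t)) = (\<lambda>t. f' (False ## t))"
      "(\<lambda>t. f (True ## t)) = (\<lambda>t. f' (True ## t))"
      using eq unfolding gf \<Phi>_def Let_def by simp_all
    have "e = e'"
      using eqs(1) by (simp add: u u')
    moreover have "word_act (u j) t = word_act (u' j) t" for j t
      using fun_cong[OF eqs(2), of t] fun_cong[OF eqs(3), of t] by (cases j) (simp_all add: u u')
    ultimately have "g (j ## t) = g' (j ## t)" for j t
      by (simp add: u u')
    then have "g x = g' x" for x
      by (metis stream.collapse)
    moreover have "f (j ## t) = f' (j ## t)" for j t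
      using fun_cong[OF eqs(4), of t] fun_cong[OF eqs(5), of t] by (cases j) simp_all
    then have "f x = f' x" for x
      by (metis stream.collapse)
    ultimately show "c = c'"
      unfolding gf by auto
  qed
  moreover have "finite T"
    unfolding T_def case_prod_unfold using fin by (intro finite_cartesian_product finite_UN_I) simp_all
  ultimately have "card (configs z Q Y n) \<le> card T"
    by (meson card_inj_on_le)
  also have "\<dots> = 2 * card (\<Union>(i, j)\<in>split_pairs n. ?C i \<times> ?C j)"
    unfolding T_def by (simp add: card_cartesian_product)
  also have "card (\<Union>(i, j)\<in>split_pairs n. ?C i \<times> ?C j) \<le> (\<Sum>(i, j)\<in>split_pairs n. card (?C i) * card (?C j))"
    using card_UN_le[of "split_pairs n" "\<lambda>(i, j). ?C i \<times> ?C j"]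
    by (simp add: case_prod_unfold card_cartesian_product)
  finally show ?thesis
    by simp
qed

text \<open>The unfolded recursion is a binary tree. Each of its \<open>2 ^ m - 1\<close> inner
  nodes costs a factor \<open>2 * (N + 1)^2\<close> for the swap bit and the pair of weights; the
  leaves are bounded trivially, and their total weight has shrunk by about
  \<open>(6 / 7) ^ m\<close>. At depth 0 the exponent is n + 1, as in the trivial bound.\<close>

lemma configs_bound:
  fixes z :: 'v
  assumes Q: "finite Q" "Q \<noteq> {}" and N: "30 \<le> N"
  shows "finite Y \<Longrightarrow> card Y \<le> k \<Longrightarrow> n \<le> N \<Longrightarrow>
    real (card (configs z Q Y n)) \<le> (2 * (real N + 1)\<^sup>2) ^ (2 ^ m - 1)
      * (4 * real (card Q) ^ (5 * k)) powr ((6 / 7) ^ m * real n + 6 * 2 ^ m - 5)"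
proof (induction m arbitrary: Y n)
  case 0
  have "real (card (configs z Q Y n)) \<le> real ((4 * card Q ^ (5 * k)) ^ Suc n)"
    using configs_trivial_bound(2)[OF 0(1,2) Q] by (subst of_nat_le_iff)
  also have "\<dots> = (4 * real (card Q) ^ (5 * k)) powr real (Suc n)"
    using Q by (subst powr_realpow) (auto simp: card_gt_0_iff)
  finally show ?case
    by (simp add: add.commute)
next
  case (Suc m)
  define P where "P = 2 * (real N + 1)\<^sup>2"
  define B where "B = 4 * real (card Q) ^ (5 * k)"
  have B: "1 \<le> B"
  proof -
    have "1 \<le> real (card Q)"
      using Q by (simp add: Suc_le_eq card_gt_0_iff)
    then have "1 \<le> real (card Q) ^ (5 * k)"
      by (rule one_le_power)
    then show ?thesis
      by (simp add: B_def)
  qed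
  have P: "0 \<le> P"
    by (simp add: P_def)
  let ?c = "\<lambda>i. real (card (configs z Q (stl ` Y) i))"
  let ?e = "\<lambda>m n. (6 / 7) ^ m * real n + 6 * 2 ^ m - (5::real)"
  \<comment> \<open>Passing to tails does not enlarge the base set, so the same \<open>k\<close>
    serves at every level.\<close>
  have Y: "finite (stl ` Y)" "card (stl ` Y) \<le> k"
    using Suc.prems card_image_le[of Y stl] by auto
  have "?c i * ?c j \<le> P ^ (2 * (2 ^ m - 1)) * B powr ?e (Suc m) n"
    if ij: "(i, j) \<in> split_pairs n" for i j
  proof -
    have "i \<le> N" "j \<le> N"
      using ij split_pairs_subset[OF Suc.prems(3) N] by auto
    then have "?c i * ?c j \<le> (P ^ (2 ^ m - 1) * B powr ?e m i) * (P ^ (2 ^ m - 1) * B powr ?e m j)"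
      using Suc.IH[OF Y] P unfolding P_def[symmetric] B_def[symmetric] by (intro mult_mono) auto
    also have "\<dots> = P ^ (2 * (2 ^ m - 1)) * B powr (?e m i + ?e m j)"
      by (simp only: mult_2 power_add powr_add mult_ac)
    also have "B powr (?e m i + ?e m j) \<le> B powr ?e (Suc m) n"
    proof (rule powr_mono[OF _ B])
      have "7 * (real i + real j) \<le> 6 * (real n + 5)"
        using ij unfolding split_pairs_def by (simp flip: of_nat_le_iff[where 'a = real])
      then have "real i + real j \<le> 6 / 7 * (real n + 5)"
        by simp
      then have "(6 / 7) ^ m * (real i + real j) \<le> (6 / 7) ^ m * (6 / 7 * (real n + 5))"
        by (intro mult_left_mono) auto
      also have "\<dots> = (6 / 7) ^ Suc m * real n + (6 / 7) ^ Suc m * 5"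
        by (simp add: algebra_simps)
      \<comment> \<open>This 5 is offset by one of the two terms -5 contributed by \<open>i\<close>
        and \<open>j\<close>; the other is the -5 of the next level.\<close>
      also have "(6 / 7 :: real) ^ Suc m * 5 \<le> 5"
        using power_le_one[of "6 / 7 :: real" "Suc m"] by simp
      finally show "?e m i + ?e m j \<le> ?e (Suc m) n"
        by (simp add: algebra_simps)
    qed
    finally show ?thesis
      using P by (simp add: mult_left_mono)
  qed
  then have "(\<Sum>(i, j)\<in>split_pairs n. ?c i * ?c j)
      \<le> (\<Sum>(i, j)\<in>split_pairs n. P ^ (2 * (2 ^ m - 1)) * B powr ?e (Suc m) n)"
    by (intro sum_mono) auto
  also have "\<dots> = real (card (split_pairs n)) * (P ^ (2 * (2 ^ m - 1)) * B powr ?e (Suc m) n)"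
    by (simp add: case_prod_unfold)
  also have "\<dots> \<le> (real N + 1)\<^sup>2 * (P ^ (2 * (2 ^ m - 1)) * B powr ?e (Suc m) n)"
  proof (rule mult_right_mono)
    have "card (split_pairs n) \<le> (N + 1)\<^sup>2"
      using card_mono[OF _ split_pairs_subset[OF Suc.prems(3) N]] by (simp add: power2_eq_square)
    then show "real (card (split_pairs n)) \<le> (real N + 1)\<^sup>2"
      by (simp flip: of_nat_le_iff[where 'a = real] add: add.commute)
  qed (use P in simp)
  finally have sum_le: "(\<Sum>(i, j)\<in>split_pairs n. ?c i * ?c j)
      \<le> (real N + 1)\<^sup>2 * (P ^ (2 * (2 ^ m - 1)) * B powr ?e (Suc m) n)" .
  have "real (card (configs z Q Y n)) \<le> 2 * (\<Sum>(i, j)\<in>split_pairs n. ?c i * ?c j)"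
    using configs_recursion[OF Suc.prems(1) Q, of z n]
    by (simp flip: of_nat_le_iff[where 'a = real] add: case_prod_unfold)
  also have "\<dots> \<le> P * (P ^ (2 * (2 ^ m - 1)) * B powr ?e (Suc m) n)"
    using sum_le by (simp add: P_def)
  also have "\<dots> = P ^ (2 ^ Suc m - 1) * B powr ?e (Suc m) n"
  proof -
    obtain l where l: "(2 ^ m :: nat) = Suc l"
      using not0_implies_Suc[of "2 ^ m"] by auto
    have "2 ^ Suc m - 1 = Suc (2 * (2 ^ m - 1 :: nat))"
      unfolding power_Suc l by simp
    then show ?thesis
      by (simp only: power_Suc mult.assoc)
  qed
  finally show ?case
    unfolding P_def B_def .
qed

section \<open>Asymptotics of the bound\<close>

lemma power_times_ln_tendsto_0:
  fixes x :: real
  assumes "0 \<le> x" "x < 1"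
  shows "(\<lambda>m. x ^ m * ln (2 * 4 ^ m + 1)) \<longlonglongrightarrow> 0"
proof (rule tendsto_sandwich[of "\<lambda>_. 0" _ _ "\<lambda>m. (of_nat m * x ^ m + x ^ m) * ln 4"])
  have "(\<lambda>m. (of_nat m * x ^ m + x ^ m) * ln 4) \<longlonglongrightarrow> (0 + 0) * ln 4"
    using assms by (intro tendsto_intros powser_times_n_limit_0 LIMSEQ_power_zero) auto
  then show "(\<lambda>m. (of_nat m * x ^ m + x ^ m) * ln 4) \<longlonglongrightarrow> 0"
    by simp
  \<comment> \<open>There are \<open>2 * 4 ^ m + 1\<close> integers of modulus at most
    \<open>4 ^ m\<close>. The logarithm is linear in \<open>m\<close>, so geometric decay beats
    it.\<close>
  have "ln (2 * 4 ^ m + 1) \<le> (real m + 1) * ln 4" for m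
  proof -
    have "2 * 4 ^ m + 1 \<le> (4 :: real) ^ Suc m"
      using one_le_power[of "4 :: real" m] unfolding power_Suc by linarith
    then have "ln (2 * 4 ^ m + 1) \<le> ln ((4 :: real) ^ Suc m)"
      by (intro ln_mono add_nonneg_pos) auto
    then show ?thesis
      unfolding ln_realpow[of 4, simplified] by (simp add: add.commute)
  qed
  then have "x ^ m * ln (2 * 4 ^ m + 1) \<le> x ^ m * ((real m + 1) * ln 4)" for m
    using assms by (intro mult_left_mono) auto
  then show "\<forall>\<^sub>F m in sequentially. x ^ m * ln (2 * 4 ^ m + 1) \<le> (of_nat m * x ^ m + x ^ m) * ln 4"
    by (simp add: algebra_simps)
  show "\<forall>\<^sub>F m in sequentially. 0 \<le> x ^ m * ln (2 * 4 ^ m + 1)"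
    using assms by (intro always_eventually allI mult_nonneg_nonneg ln_ge_zero) auto
qed simp

text \<open>The first summand comes from the inner nodes of the recursion tree and the second from
  its leaves, both divided by \<open>4 ^ m\<close>; \<open>c\<close> stands for the bound on the
  base set. Each is geometric decay times a factor at most linear in \<open>m\<close>.\<close>

lemma growth_exponent_tendsto:
  fixes c :: real
  shows "(\<lambda>m::nat. (1 / 2) ^ m * (2 * (ln 6 + ln (2 * 4 ^ m + 1)))
      + (6 * (6 / 7) ^ m + 6 * (1 / 2) ^ m) * (ln 4 + 5 * c * (ln (2 * c) + ln (2 * 4 ^ m + 1))))
    \<longlonglongrightarrow> 0" (is "?f \<longlonglongrightarrow> 0")
proof -
  define D :: "nat \<Rightarrow> real" where "D m = 6 * (6 / 7) ^ m + 6 * (1 / 2) ^ m" for m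
  have "(\<lambda>m. 2 * ln 6 * (1 / 2) ^ m + 2 * ((1 / 2) ^ m * ln (2 * 4 ^ m + 1)))
      \<longlonglongrightarrow> 2 * ln 6 * 0 + (2 :: real) * 0"
    by (intro tendsto_intros power_times_ln_tendsto_0 LIMSEQ_power_zero) auto
  then have "(\<lambda>m. (1 / 2) ^ m * (2 * (ln 6 + ln (2 * 4 ^ m + 1)))) \<longlonglongrightarrow> (0 :: real)"
    by (simp add: algebra_simps)
  moreover have "D \<longlonglongrightarrow> 6 * 0 + 6 * 0"
    unfolding D_def by (intro tendsto_intros LIMSEQ_power_zero) auto
  moreover have "(\<lambda>m. 6 * ((6 / 7) ^ m * ln (2 * 4 ^ m + 1)) + 6 * ((1 / 2) ^ m * ln (2 * 4 ^ m + 1)))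
        \<longlonglongrightarrow> 6 * 0 + (6 :: real) * 0"
    by (intro tendsto_intros power_times_ln_tendsto_0) auto
  then have "(\<lambda>m. D m * ln (2 * 4 ^ m + 1)) \<longlonglongrightarrow> 0"
    unfolding D_def by (simp add: algebra_simps)
  ultimately have "(\<lambda>m. (1 / 2) ^ m * (2 * (ln 6 + ln (2 * 4 ^ m + 1)))
      + D m * (ln 4 + 5 * c * ln (2 * c)) + 5 * c * (D m * ln (2 * 4 ^ m + 1)))
    \<longlonglongrightarrow> 0 + (6 * 0 + 6 * 0) * (ln 4 + 5 * c * ln (2 * c)) + 5 * c * 0"
    by (intro tendsto_intros)
  also have "(\<lambda>m. (1 / 2) ^ m * (2 * (ln 6 + ln (2 * 4 ^ m + 1)))
      + D m * (ln 4 + 5 * c * ln (2 * c)) + 5 * c * (D m * ln (2 * 4 ^ m + 1))) = ?f"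
    unfolding D_def[symmetric] by (simp add: fun_eq_iff algebra_simps)
  finally show ?thesis
    by simp
qed

text \<open>Depth \<open>m\<close> is matched with radius \<open>4 ^ m\<close>: both the number of
  inner nodes, below \<open>2 ^ m\<close>, and the leaf exponent
  \<open>6 * (6 / 7) ^ m * 4 ^ m + 6 * 2 ^ m\<close> are of smaller order than the radius, while for
  fixed \<open>k\<close> the logarithms of the factors grow only linearly in
  \<open>m\<close>.\<close>

lemma root_card_configs_le:
  fixes z :: 'v
  assumes Y: "finite Y" "card Y \<le> k" and k: "1 \<le> k" and Q: "finite Q" "Q \<noteq> {}"
    and card_Q: "card Q \<le> k * (2 * 4 ^ m + 1) + 1" and m: "2 \<le> m"
  shows "root (4 ^ m) (real (card (configs z Q Y (6 * 4 ^ m))))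
    \<le> exp ((1 / 2) ^ m * (2 * (ln 6 + ln (2 * 4 ^ m + 1)))
      + (6 * (6 / 7) ^ m + 6 * (1 / 2) ^ m) * (ln 4 + 5 * k * (ln (2 * k) + ln (2 * 4 ^ m + 1))))"
proof -
  define N :: nat where "N = 6 * 4 ^ m"
  define P where "P = 2 * (real N + 1)\<^sup>2"
  define B where "B = 4 * real (card Q) ^ (5 * k)"
  define E where "E = (6 / 7) ^ m * real N + 6 * 2 ^ m - 5"
  define U where "U = P ^ (2 ^ m - 1) * B powr E"
  define x where "x = ln (2 * 4 ^ m + 1 :: real)"
  have four: "(1 :: real) \<le> 4 ^ m"
    by simp
  \<comment> \<open>Here \<open>2 \<le> m\<close> enters: for \<open>m = 1\<close> the weight bound
    would be 24.\<close>
  have N: "30 \<le> N"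
    using power_increasing[OF m, of "4 :: nat"] unfolding N_def by simp
  have real_N: "real N = 6 * 4 ^ m"
    by (simp add: N_def)
  have q1: "1 \<le> real (card Q)"
    using Q by (simp add: Suc_le_eq card_gt_0_iff)
  have B: "1 \<le> B"
    using one_le_power[OF q1, of "5 * k"] unfolding B_def by linarith
  have P: "1 \<le> P"
    unfolding P_def by (simp add: power2_eq_square algebra_simps)
  have U: "0 < U"
    using P B unfolding U_def by (intro mult_pos_pos zero_less_power) auto
  have "ln q \<le> ln (2 * real k) + x" if "q = real (card Q)" for q
  proof -
    have "q \<le> real (k * (2 * 4 ^ m + 1) + 1)"
      using card_Q unfolding that by (rule of_nat_mono)
    also have "\<dots> = real k * (2 * 4 ^ m + 1) + 1"
      by (simp add: algebra_simps)
    also have "\<dots> \<le> 2 * real k * (2 * 4 ^ m + 1)"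
    proof -
      have "1 * 1 \<le> real k * (2 * 4 ^ m + 1)"
        using k by (intro mult_mono) auto
      then show ?thesis
        by simp
    qed
    finally have "ln q \<le> ln (2 * real k * (2 * 4 ^ m + 1))"
      using q1 that by (intro ln_mono) auto
    also have "\<dots> = ln (2 * real k) + x"
      unfolding x_def using k four by (intro ln_mult_pos) (auto intro: add_pos_pos)
    finally show ?thesis .
  qed
  then have "ln (real (card Q)) \<le> ln (2 * real k) + x"
    by blast
  then have lnB: "ln B \<le> ln 4 + 5 * real k * (ln (2 * real k) + x)"
    using q1 unfolding B_def by (subst ln_mult_pos) (auto simp: ln_realpow mult_left_mono)
  have lnP: "ln P \<le> 2 * (ln 6 + x)"
  proof -
    have "P \<le> (6 * (2 * 4 ^ m + 1))\<^sup>2"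
      unfolding P_def real_N using four by (simp add: power2_eq_square algebra_simps)
    then have "ln P \<le> ln ((6 * (2 * 4 ^ m + 1))\<^sup>2)"
      using P by (intro ln_mono) auto
    also have "\<dots> = 2 * ln (6 * (2 * 4 ^ m + 1 :: real))"
      using four by (subst ln_realpow) (auto intro: add_pos_pos)
    also have "ln (6 * (2 * 4 ^ m + 1 :: real)) = ln 6 + x"
      unfolding x_def using four by (intro ln_mult_pos) (auto intro: add_pos_pos)
    finally show ?thesis .
  qed
  have "ln U = real (2 ^ m - 1) * ln P + E * ln B"
    using P B unfolding U_def by (subst ln_mult_pos) (auto simp: ln_realpow ln_powr)
  also have "\<dots> \<le> 2 ^ m * ln P + (6 * (6 / 7) ^ m * 4 ^ m + 6 * 2 ^ m) * ln B"
  proof (intro add_mono mult_right_mono)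
    show "real (2 ^ m - 1) \<le> 2 ^ m"
      by (simp add: of_nat_diff)
  qed (use P B in \<open>auto simp: E_def real_N\<close>)
  also have "\<dots> \<le> 2 ^ m * (2 * (ln 6 + x)) + (6 * (6 / 7) ^ m * 4 ^ m + 6 * 2 ^ m) *
      (ln 4 + 5 * real k * (ln (2 * real k) + x))" (is "_ \<le> ?V")
    using lnB lnP by (intro add_mono mult_left_mono) auto
  finally have "ln U / 4 ^ m \<le> ?V / 4 ^ m"
    by (intro divide_right_mono) auto
  also have "?V / 4 ^ m = (1 / 2) ^ m * (2 * (ln 6 + x))
      + (6 * (6 / 7) ^ m + 6 * (1 / 2) ^ m) * (ln 4 + 5 * real k * (ln (2 * real k) + x))"
  proof -
    have two: "(2 :: real) ^ m = (1 / 2) ^ m * 4 ^ m"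
      by (simp flip: power_mult_distrib)
    have "(h * f * u + (6 * t * f + 6 * (h * f)) * v) / f = h * u + (6 * t + 6 * h) * v"
      if "f \<noteq> 0" for f h t u v :: real
      using that by (simp add: field_simps)
    then show ?thesis
      unfolding two by simp
  qed
  finally have exponent: "ln U / 4 ^ m \<le> (1 / 2) ^ m * (2 * (ln 6 + x))
      + (6 * (6 / 7) ^ m + 6 * (1 / 2) ^ m) * (ln 4 + 5 * real k * (ln (2 * real k) + x))" .
  have "real (card (configs z Q Y N)) \<le> U"
    using configs_bound[OF Q N Y order_refl] unfolding U_def P_def B_def E_def .
  then have "root (4 ^ m) (real (card (configs z Q Y N))) \<le> root (4 ^ m) U"
    by (intro real_root_le_mono) auto
  also have "\<dots> = exp (ln U / 4 ^ m)"
    using U by (simp add: root_powr_inverse powr_def)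
  also have "\<dots> \<le> exp ((1 / 2) ^ m * (2 * (ln 6 + x))
      + (6 * (6 / 7) ^ m + 6 * (1 / 2) ^ m) * (ln 4 + 5 * real k * (ln (2 * real k) + x)))"
    using exponent by simp
  finally show ?thesis
    unfolding N_def x_def .
qed

section \<open>Growth rates\<close>

text \<open>Fekete's lemma. Dividing n by a fixed p with remainder gives a n <= q (a p) + O(1), so
  the quotients are eventually below any number exceeding a p / p.\<close>

lemma subadditive_tendsto_Inf:
  fixes a :: "nat \<Rightarrow> real"
  assumes nonneg: "\<And>n. 0 \<le> a n" and subadd: "\<And>m n. a (m + n) \<le> a m + a n"
  shows "(\<lambda>n. a n / real n) \<longlonglongrightarrow> (INF n\<in>{1..}. a n / real n)"
proof -
  define L where "L = (INF n\<in>{1..}. a n / real n)"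
  have bdd: "bdd_below ((\<lambda>n. a n / real n) ` {1..})"
    by (rule bdd_belowI[of _ 0]) (auto simp: nonneg)
  have mult: "a (q * p) \<le> real q * a p" if "1 \<le> q" for p q
    using that
  proof (induction q rule: dec_induct)
    case (step q)
    then show ?case
      using subadd[of p "q * p"] by (simp add: algebra_simps)
  qed simp
  have "(\<lambda>n. a n / real n) \<longlonglongrightarrow> L"
  proof (rule order_tendstoI)
    fix y assume "y < L"
    have "L \<le> a n / real n" if "1 \<le> n" for n
      unfolding L_def using that by (intro cINF_lower bdd) auto
    then have "\<forall>n\<ge>1. y < a n / real n"
      using \<open>y < L\<close> by (meson less_le_trans)
    then show "\<forall>\<^sub>F n in sequentially. y < a n / real n"
      unfolding eventually_sequentially by blast
  next
    fix y assume "L < y"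
    then obtain p where p: "1 \<le> p" "a p / real p < y"
      unfolding L_def using cINF_less_iff[OF _ bdd, of y] by auto
    \<comment> \<open>A bound, independent of \<open>n\<close>, for \<open>a\<close> at every
      remainder modulo \<open>p\<close>.\<close>
    define M where "M = Max (a ` {..p}) + a 0"
    have M: "a r + a 0 \<le> M" if "r \<le> p" for r
      unfolding M_def using that by simp
    have bound: "a n / real n \<le> a p / real p + M / real n" if "p \<le> n" for n
    proof -
      define q r where "q = n div p" and "r = n mod p"
      have n: "n = q * p + r" "r \<le> p" "1 \<le> q"
        using p that by (auto simp: q_def r_def Suc_le_eq div_greater_zero_iff)
      have "a n \<le> real q * a p + a r"
        unfolding n(1) using subadd[of "q * p" r] mult[OF n(3), of p] by linarith
      also have "real q * a p \<le> real n * (a p / real p)"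
      proof -
        have "real q * a p = (real q * real p) * (a p / real p)"
          using p by simp
        also have "\<dots> \<le> real n * (a p / real p)"
          using n(1) nonneg[of p] by (intro mult_right_mono) (simp_all flip: of_nat_mult)
        finally show ?thesis .
      qed
      also have "a r \<le> M"
        using M[OF n(2)] nonneg[of 0] by linarith
      finally have "a n \<le> real n * (a p / real p) + M"
        by simp
      moreover have "0 < real n"
        using p that by simp
      ultimately show ?thesis
        by (simp add: field_simps)
    qed
    have "(\<lambda>n. a p / real p + M / real n) \<longlonglongrightarrow> a p / real p"
      by (rule tendsto_eq_intros tendsto_divide_0 filterlim_real_sequentially | simp)+
    then have "\<forall>\<^sub>F n in sequentially. a p / real p + M / real n < y"
      using p(2) by (rule order_tendstoD(2))
    then show "\<forall>\<^sub>F n in sequentially. a n / real n < y"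
      using eventually_ge_at_top[of p]
      by eventually_elim (use bound in \<open>meson le_less_trans\<close>)
  qed
  then show ?thesis
    by (simp add: L_def)
qed

text \<open>Fekete's lemma for \<open>ln (u n)\<close>. Since the limit is an infimum, a single
  \<open>n\<close> already bounds it from above; later one ball thus controls the growth
  rate.\<close>

lemma submultiplicative_root_tendsto:
  fixes u :: "nat \<Rightarrow> real"
  assumes ge_1: "\<And>n. 1 \<le> u n" and submult: "\<And>m n. u (m + n) \<le> u m * u n"
  shows "\<exists>L. (\<lambda>n. root n (u n)) \<longlonglongrightarrow> L \<and> 1 \<le> L \<and> (\<forall>n\<ge>1. L \<le> root n (u n))"
proof -
  define a where "a n = ln (u n)" for n
  define L where "L = (INF n\<in>{1..}. a n / real n)"
  have pos: "0 < u n" for n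
    using ge_1[of n] by linarith
  have nonneg: "0 \<le> a n" for n
    using ge_1 by (simp add: a_def)
  have "a (m + n) \<le> a m + a n" for m n
    using submult[of m n] pos by (simp add: a_def flip: ln_mult_pos)
  then have lim: "(\<lambda>n. a n / real n) \<longlonglongrightarrow> L"
    unfolding L_def by (intro subadditive_tendsto_Inf nonneg)
  have root_eq: "root n (u n) = exp (a n / real n)" if "1 \<le> n" for n
    using that pos[of n] by (simp add: a_def root_powr_inverse powr_def)
  have "(\<lambda>n. root n (u n)) \<longlonglongrightarrow> exp L"
  proof (rule Lim_transform_eventually)
    show "(\<lambda>n. exp (a n / real n)) \<longlonglongrightarrow> exp L"
      using lim by (rule tendsto_exp)
    show "\<forall>\<^sub>F n in sequentially. exp (a n / real n) = root n (u n)"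
      using root_eq by (intro eventually_sequentiallyI[of 1]) simp
  qed
  moreover have "0 \<le> L"
    unfolding L_def using nonneg by (intro cINF_greatest) auto
  moreover have "exp L \<le> root n (u n)" if "1 \<le> n" for n
  proof -
    have "bdd_below ((\<lambda>n. a n / real n) ` {1..})"
      by (rule bdd_belowI[of _ 0]) (auto simp: nonneg)
    then have "L \<le> a n / real n"
      unfolding L_def using that by (intro cINF_lower) auto
    then show ?thesis
      unfolding root_eq[OF that] by simp
  qed
  ultimately show ?thesis
    by (intro exI[of _ "exp L"]) auto
qed

section \<open>Balls and growth rates in a group\<close>

lemma word_ballI: "set w \<subseteq> S \<union> m_inv G ` S \<Longrightarrow> length w \<le> R \<Longrightarrow> foldr (mult G) w \<one>\<^bsub>G\<^esub> \<in> word_ball G S R"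
  unfolding word_ball_def by blast

lemma finite_word_ball:
  assumes "finite S"
  shows "finite (word_ball G S R)"
proof -
  have "word_ball G S R = (\<lambda>w. foldr (mult G) w \<one>\<^bsub>G\<^esub>) ` {w. set w \<subseteq> S \<union> m_inv G ` S \<and> length w \<le> R}"
    unfolding word_ball_def by blast
  then show ?thesis
    using assms by (simp add: finite_lists_length_le)
qed

context group
begin

lemma foldr_mult_closed: "set w \<subseteq> carrier G \<Longrightarrow> foldr (mult G) w \<one> \<in> carrier G"
  by (induction w) auto

lemma foldr_mult_append:
  assumes "set u \<subseteq> carrier G" "set w \<subseteq> carrier G"
  shows "foldr (mult G) (u @ w) \<one> = foldr (mult G) u \<one> \<otimes> foldr (mult G) w \<one>"
  using assms by (induction u) (auto simp: foldr_mult_closed m_assoc simp del: foldr_append)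

lemma symmetrized_subset: "S \<subseteq> carrier G \<Longrightarrow> S \<union> m_inv G ` S \<subseteq> carrier G"
  by auto

lemma growth_function_ge_1:
  assumes "finite S"
  shows "1 \<le> growth_function G S R"
proof -
  have "\<one> \<in> word_ball G S R"
    using word_ballI[of "[]" S G R] by simp
  then show ?thesis
    using finite_word_ball[OF assms] unfolding growth_function_def
    by (metis One_nat_def Suc_leI card_gt_0_iff empty_iff)
qed

text \<open>Cut a word of length at most m + n after its first m letters.\<close>

lemma growth_function_submult:
  assumes "finite S" "S \<subseteq> carrier G"
  shows "growth_function G S (m + n) \<le> growth_function G S m * growth_function G S n"
proof -
  let ?B = "word_ball G S"
  have "?B (m + n) \<subseteq> (\<lambda>(x, y). x \<otimes> y) ` (?B m \<times> ?B n)"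
  proof
    fix x assume "x \<in> ?B (m + n)"
    then obtain w where w: "set w \<subseteq> S \<union> m_inv G ` S" "length w \<le> m + n" "x = foldr (mult G) w \<one>"
      unfolding word_ball_def by blast
    have sub: "set (take m w) \<subseteq> S \<union> m_inv G ` S" "set (drop m w) \<subseteq> S \<union> m_inv G ` S"
      using w(1) set_take_subset set_drop_subset by (meson order_trans)+
    then have "x = foldr (mult G) (take m w) \<one> \<otimes> foldr (mult G) (drop m w) \<one>"
      using foldr_mult_append[of "take m w" "drop m w"] symmetrized_subset[OF assms(2)] w(3)
      by (metis append_take_drop_id order_trans)
    moreover have "foldr (mult G) (take m w) \<one> \<in> ?B m" "foldr (mult G) (drop m w) \<one> \<in> ?B n"
      using sub w(2) by (auto intro!: word_ballI)
    ultimately show "x \<in> (\<lambda>(x, y). x \<otimes> y) ` (?B m \<times> ?B n)"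
      by auto
  qed
  moreover have fin: "finite (?B m \<times> ?B n)"
    by (intro finite_cartesian_product finite_word_ball assms)
  ultimately have "card (?B (m + n)) \<le> card (?B m \<times> ?B n)"
    using surj_card_le by blast
  then show ?thesis
    unfolding growth_function_def by (simp add: card_cartesian_product)
qed

lemma growth_rate_bounds:
  assumes "finite S" "S \<subseteq> carrier G"
  shows growth_rate_tendsto:
      "(\<lambda>R. root R (real (growth_function G S R))) \<longlonglongrightarrow> growth_rate G S"
    and growth_rate_ge_1: "1 \<le> growth_rate G S"
    and growth_rate_le: "1 \<le> R \<Longrightarrow> growth_rate G S \<le> root R (real (growth_function G S R))"
proof -
  have "1 \<le> real (growth_function G S n)" for n
    using growth_function_ge_1[OF assms(1), of n] by simp
  moreover have "real (growth_function G S (m + n))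
      \<le> real (growth_function G S m) * real (growth_function G S n)" for m n
    using growth_function_submult[OF assms, of m n] by (simp flip: of_nat_mult)
  ultimately obtain L where L: "(\<lambda>R. root R (real (growth_function G S R))) \<longlonglongrightarrow> L" "1 \<le> L"
      "\<forall>R\<ge>1. L \<le> root R (real (growth_function G S R))"
    using submultiplicative_root_tendsto[of "\<lambda>R. real (growth_function G S R)"] by blast
  have "growth_rate G S = L"
    unfolding growth_rate_def using L(1) by (rule limI)
  with L show "(\<lambda>R. root R (real (growth_function G S R))) \<longlonglongrightarrow> growth_rate G S"
    "1 \<le> growth_rate G S"
    "1 \<le> R \<Longrightarrow> growth_rate G S \<le> root R (real (growth_function G S R))"
    by simp_all
qed

end

lemma growth_rate_mono:
  assumes "group G" "group H" "finite S" "S \<subseteq> carrier G" "finite T" "T \<subseteq> carrier H"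
    and "\<And>R. growth_function G S R \<le> growth_function H T R"
  shows "growth_rate G S \<le> growth_rate H T"
proof (rule LIMSEQ_le)
  show "(\<lambda>R. root R (real (growth_function G S R))) \<longlonglongrightarrow> growth_rate G S"
    using assms by (intro group.growth_rate_tendsto)
  show "(\<lambda>R. root R (real (growth_function H T R))) \<longlonglongrightarrow> growth_rate H T"
    using assms by (intro group.growth_rate_tendsto)
  show "\<exists>N. \<forall>R\<ge>N. root R (real (growth_function G S R)) \<le> root R (real (growth_function H T R))"
    using assms(7) by (intro exI[of _ 1] allI impI real_root_le_mono) auto
qed

section \<open>The Grigorchuk group and its orbit\<close>

lemma group_right_sym_group: "group (right_sym_group TYPE('x))"
proof (rule groupI)
  fix g :: "'x \<Rightarrow> 'x" assume "g \<in> carrier (right_sym_group TYPE('x))"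
  then show "\<exists>h\<in>carrier (right_sym_group TYPE('x)). h \<otimes>\<^bsub>right_sym_group TYPE('x)\<^esub> g = \<one>\<^bsub>right_sym_group TYPE('x)\<^esub>"
    unfolding right_sym_group_def
    by (intro bexI[of _ "inv_into UNIV g"]) (auto simp: bij_imp_bij_inv fun_eq_iff bij_is_surj surj_f_inv_f)
qed (auto simp: right_sym_group_def bij_comp comp_assoc)

lemma mult_grigorchuk_group [simp]: "g \<otimes>\<^bsub>grigorchuk_group\<^esub> h = h \<circ> g"
  by (simp add: grigorchuk_group_def right_sym_group_def)

lemma one_grigorchuk_group [simp]: "\<one>\<^bsub>grigorchuk_group\<^esub> = id"
  by (simp add: grigorchuk_group_def right_sym_group_def)

lemma letter_act_involution [simp]: "letter_act s (letter_act s t) = t"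
  by (cases s) (simp_all add: grig_a_involution grig_bcd_involution)

lemma word_act_rev: "word_act (rev w) (word_act w t) = t"
  by (induction w arbitrary: t) auto

lemma range_letter_act: "range letter_act = {grig_a, grig_b, grig_c, grig_d}"
proof -
  have "letter_act s \<in> {grig_a, grig_b, grig_c, grig_d}" for s
    by (cases s; cases "the s") (auto simp: grig_b_def grig_c_def grig_d_def)
  moreover have "grig_a = letter_act None" "grig_b = letter_act (Some Gen_b)"
    "grig_c = letter_act (Some Gen_c)" "grig_d = letter_act (Some Gen_d)"
    by (simp_all add: grig_b_def grig_c_def grig_d_def)
  ultimately show ?thesis
    by blast
qed

lemma inv_right_sym_letter:
  "inv\<^bsub>right_sym_group TYPE(bool stream)\<^esub> letter_act s = letter_act s"
proof -
  have "letter_act s \<in> carrier (right_sym_group TYPE(bool stream))"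
    using grig_generators_in_carrier range_letter_act by blast
  then show ?thesis
    by (intro group.inv_equality[OF group_right_sym_group]) (auto simp: right_sym_group_def fun_eq_iff)
qed

text \<open>The generators are their own inverses, so words without inverse letters exhaust the
  group.\<close>

lemma carrier_grigorchuk_group: "carrier grigorchuk_group = range word_act"
proof
  let ?S = "right_sym_group TYPE(bool stream)"
  have carrier: "carrier grigorchuk_group = generate ?S (range letter_act)"
    unfolding grigorchuk_group_def carrier_subgroup_generated range_letter_act
    using grig_generators_in_carrier by (simp add: Int_absorb1)
  show "carrier grigorchuk_group \<subseteq> range word_act"
  proof
    fix g assume "g \<in> carrier grigorchuk_group"
    then have "g \<in> generate ?S (range letter_act)"
      using carrier by simp
    then show "g \<in> range word_act"
    proof (induction rule: generate.induct)
      case one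
      have "\<one>\<^bsub>?S\<^esub> = word_act []"
        by (simp add: right_sym_group_def)
      then show ?case
        by blast
    next
      case (incl h)
      then obtain s where "h = word_act [s]"
        by auto
      then show ?case
        by blast
    next
      case (inv h)
      then obtain s where "inv\<^bsub>?S\<^esub> h = word_act [s]"
        using inv_right_sym_letter by auto
      then show ?case
        by blast
    next
      case (eng h1 h2)
      then obtain u w where "h1 = word_act u" "h2 = word_act w"
        by blast
      then have "h1 \<otimes>\<^bsub>?S\<^esub> h2 = word_act (u @ w)"
        by (simp add: right_sym_group_def)
      then show ?case
        by blast
    qed
  qed
  show "range word_act \<subseteq> carrier grigorchuk_group"
  proof
    fix g assume "g \<in> range word_act"
    then obtain w where "g = word_act w"
      by blast
    moreover have "word_act w \<in> generate ?S (range letter_act)"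
    proof (induction w)
      case Nil
      show ?case
        using generate.one[of ?S "range letter_act"] by (simp add: right_sym_group_def id_def)
    next
      case (Cons s w)
      have "letter_act s \<in> generate ?S (range letter_act)"
        by (simp add: generate.incl)
      from generate.eng[OF this Cons] show ?case
        by (simp add: right_sym_group_def comp_def)
    qed
    ultimately show "g \<in> carrier grigorchuk_group"
      using carrier by simp
  qed
qed

lemma grigorchuk_orbit_eq: "grigorchuk_orbit = range (\<lambda>w. word_act w (sconst False))"
  unfolding grigorchuk_orbit_def orbit_def carrier_grigorchuk_group by auto

lemma word_act_in_orbit [simp]:
  assumes "x \<in> grigorchuk_orbit"
  shows "word_act w x \<in> grigorchuk_orbit"
proof -
  obtain u where "x = word_act u (sconst False)"
    using assms unfolding grigorchuk_orbit_eq by blast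
  then have "word_act w x = word_act (u @ w) (sconst False)"
    by simp
  then show ?thesis
    unfolding grigorchuk_orbit_eq by blast
qed

lemma letter_act_in_orbit [simp]: "x \<in> grigorchuk_orbit \<Longrightarrow> letter_act s x \<in> grigorchuk_orbit"
  using word_act_in_orbit[of x "[s]"] by simp

lemma orbit_transitive:
  assumes "x \<in> grigorchuk_orbit" "y \<in> grigorchuk_orbit"
  obtains w where "y = word_act w x"
proof -
  obtain u v where "x = word_act u (sconst False)" "y = word_act v (sconst False)"
    using assms unfolding grigorchuk_orbit_eq by blast
  then have "y = word_act (rev u @ v) x"
    by (simp add: word_act_rev)
  then show thesis
    by (rule that)
qed

section \<open>Transitivity on levels and infinitude of the orbit\<close>

lemma word_act_lift_True: "\<exists>u. \<forall>t. word_act u (True ## t) = True ## word_act w t"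
proof (induction w)
  case Nil
  show ?case
    by (intro exI[of _ "[]"]) simp
next
  case (Cons s w)
  then obtain u where u: "\<And>t. word_act u (True ## t) = True ## word_act w t"
    by blast
  \<comment> \<open>The letter \<open>a\<close> lifts to \<open>aba\<close>, since \<open>b\<close>
    acts as \<open>a\<close> below 0; a letter \<open>q\<close> lifts to the one whose section at 1
    is \<open>q\<close>, namely its second cyclic successor.\<close>
  have "\<exists>v. \<forall>t. word_act v (True ## t) = True ## letter_act s t"
  proof (cases s)
    case None
    then show ?thesis
      by (intro exI[of _ "[None, Some Gen_b, None]"]) simp
  next
    case (Some q)
    then show ?thesis
      by (intro exI[of _ "[Some (next_bcd (next_bcd q))]"]) (cases q; simp)
  qed
  then obtain v where "\<And>t. word_act v (True ## t) = True ## letter_act s t"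
    by blast
  with u show ?case
    by (intro exI[of _ "v @ u"]) simp
qed

text \<open>Move the first letter to 1, correct the tail by induction with a word lifted to the
  subtree of 1, then set the first letter.\<close>

lemma level_transitive: "\<exists>w. stake (length p) (word_act w x) = p"
proof (induction p arbitrary: x)
  case (Cons j p)
  have first: "\<exists>w. word_act w y = k ## stl y" for y k
  proof (cases "shd y = k")
    case True
    then have "word_act [] y = k ## stl y"
      using stream.collapse[of y] by simp
    then show ?thesis
      by blast
  next
    case False
    then have "word_act [None] y = k ## stl y"
      by (simp add: grig_a_def)
    then show ?thesis
      by blast
  qed
  obtain u where u: "word_act u x = True ## stl x"
    using first by blast
  obtain w where w: "stake (length p) (word_act w (stl x)) = p"
    using Cons by blast
  obtain w' where w': "\<And>t. word_act w' (True ## t) = True ## word_act w t"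
    using word_act_lift_True[of w] by blast
  obtain v where v: "word_act v (True ## word_act w (stl x)) = j ## word_act w (stl x)"
    using first[of "True ## word_act w (stl x)" j] by auto
  have "word_act (u @ w' @ v) x = j ## word_act w (stl x)"
    using u w' v by simp
  then have "stake (length (j # p)) (word_act (u @ w' @ v) x) = j # p"
    using w by simp
  then show ?case
    by blast
qed simp

text \<open>All \<open>2 ^ n\<close> prefixes of length \<open>n\<close> occur in the orbit; taking
  \<open>n\<close> to be its supposed cardinality contradicts n < 2^n.\<close>

lemma infinite_grigorchuk_orbit: "infinite grigorchuk_orbit"
proof
  assume fin: "finite grigorchuk_orbit"
  define n where "n = card grigorchuk_orbit"
  have "{p :: bool list. set p \<subseteq> UNIV \<and> length p = n} \<subseteq> stake n ` grigorchuk_orbit"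
  proof
    fix p :: "bool list" assume "p \<in> {p. set p \<subseteq> UNIV \<and> length p = n}"
    then obtain w where "stake n (word_act w (sconst False)) = p"
      using level_transitive[of p "sconst False"] by auto
    then show "p \<in> stake n ` grigorchuk_orbit"
      unfolding grigorchuk_orbit_eq by blast
  qed
  then have "card {p :: bool list. set p \<subseteq> UNIV \<and> length p = n} \<le> n"
    using card_mono[OF finite_imageI[OF fin]] card_image_le[OF fin] unfolding n_def by (meson le_trans)
  then have "2 ^ n \<le> n"
    by (simp add: card_lists_length_eq[of "UNIV :: bool set", simplified])
  then show False
    using less_exp[of n] by simp
qed

section \<open>Base points with disjoint balls in the Schreier graph\<close>

definition separated :: "('s \<Rightarrow> bool stream) \<Rightarrow> 's set \<Rightarrow> nat \<Rightarrow> bool" where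
  "separated p S R \<longleftrightarrow> (\<forall>s\<in>S. \<forall>s'\<in>S. \<forall>u v. length u \<le> R \<longrightarrow> length v \<le> R \<longrightarrow>
     word_act u (p s) = word_act v (p s') \<longrightarrow> s = s')"

lemma separatedD:
  "separated p S R \<Longrightarrow> s \<in> S \<Longrightarrow> s' \<in> S \<Longrightarrow> word_act u (p s) = word_act v (p s') \<Longrightarrow>
     length u \<le> R \<Longrightarrow> length v \<le> R \<Longrightarrow> s = s'"
  unfolding separated_def by blast

text \<open>Greedy choice: the balls of radius 2R around the points chosen so far are finite, and
  the orbit is infinite.\<close>

lemma separated_basepoints_exist:
  assumes "finite S"
  shows "\<exists>p. (\<forall>s\<in>S. p s \<in> grigorchuk_orbit) \<and> separated p S R"
  using assms
proof (induction S)
  case (insert a S)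
  then obtain p where p: "\<forall>s\<in>S. p s \<in> grigorchuk_orbit" "separated p S R"
    by blast
  define W where "W = {w :: bcd option list. set w \<subseteq> UNIV \<and> length w \<le> R + R}"
  have fin: "finite ((\<lambda>(w, s). word_act w (p s)) ` (W \<times> S))"
    unfolding W_def using insert(1) by (intro finite_imageI finite_cartesian_product finite_lists_length_le) auto
  obtain x where x: "x \<in> grigorchuk_orbit" "x \<notin> (\<lambda>(w, s). word_act w (p s)) ` (W \<times> S)"
    using infinite_grigorchuk_orbit fin by (meson finite_subset subsetI)
  have apart: "word_act u x \<noteq> word_act v (p s)" if "s \<in> S" "length u \<le> R" "length v \<le> R" for s u v
  proof
    assume "word_act u x = word_act v (p s)"
    then have "x = word_act (v @ rev u) (p s)"
      by (metis comp_apply word_act_append word_act_rev)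
    moreover have "v @ rev u \<in> W"
      using that by (simp add: W_def)
    ultimately show False
      using x(2) that(1) by force
  qed
  show ?case
    unfolding separated_def
  proof (intro exI[of _ "p(a := x)"] conjI ballI allI impI)
    show "(p(a := x)) s \<in> grigorchuk_orbit" if "s \<in> insert a S" for s
      using that p(1) x(1) by auto
    fix s s' u v
    assume s: "s \<in> insert a S" "s' \<in> insert a S" and uv: "length u \<le> R" "length v \<le> R"
      and eq: "word_act u ((p(a := x)) s) = word_act v ((p(a := x)) s')"
    show "s = s'"
    proof (cases "s = a"; cases "s' = a")
      assume "s = a" "s' \<noteq> a"
      then show ?thesis
        using apart[of s' u v] s uv eq by auto
    next
      assume "s \<noteq> a" "s' = a"
      then show ?thesis
        using apart[of s v u] s uv eq by auto
    next
      assume "s \<noteq> a" "s' \<noteq> a"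
      then show ?thesis
        using separatedD[OF p(2), of s s' u v] s uv eq by auto
    qed simp
  qed
qed (simp add: separated_def)

section \<open>The wreath product\<close>

lemma inj_word_act: "inj (word_act w)"
  by (rule inj_on_inverseI[of _ "word_act (rev w)"]) (rule word_act_rev)

lemma word_act_rev': "word_act w (word_act (rev w) t) = t"
  using word_act_rev[of "rev w" t] by simp

locale grigorchuk_wreath = group G for G :: "('a, 'b) monoid_scheme" (structure)
begin

definition W :: "((bool stream \<Rightarrow> 'a) \<times> (bool stream \<Rightarrow> bool stream)) monoid" where
  "W = perm_wreath_product G grigorchuk_orbit (\<lambda>x g. g x) grigorchuk_group"

abbreviation "X \<equiv> grigorchuk_orbit"

abbreviation base where "base \<equiv> {f \<in> X \<rightarrow>\<^sub>E carrier G. finite {x \<in> X. f x \<noteq> \<one>}}"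

lemma carrier_W: "carrier W = base \<times> range word_act"
  by (simp add: W_def perm_wreath_product_def semidirect_product_def carrier_sum_group
      is_group carrier_grigorchuk_group)

lemma mult_W [simp]: "(f, h) \<otimes>\<^bsub>W\<^esub> (f', h') = (\<lambda>x\<in>X. f x \<otimes> f' (h x), h' \<circ> h)"
  by (auto simp: W_def perm_wreath_product_def semidirect_product_def)

lemma one_W [simp]: "\<one>\<^bsub>W\<^esub> = (\<lambda>x\<in>X. \<one>, id)"
  by (simp add: W_def perm_wreath_product_def semidirect_product_def)

lemma base_closed [simp]: "f \<in> base \<Longrightarrow> x \<in> X \<Longrightarrow> f x \<in> carrier G"
  by auto

lemma base_translate:
  assumes "f \<in> base"
  shows "(\<lambda>x\<in>X. f (word_act w x)) \<in> base"
proof -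
  have "finite (word_act w -` {x \<in> X. f x \<noteq> \<one>})"
    using assms by (intro finite_vimageI inj_word_act) auto
  moreover have "{x \<in> X. (\<lambda>x\<in>X. f (word_act w x)) x \<noteq> \<one>} \<subseteq> word_act w -` {x \<in> X. f x \<noteq> \<one>}"
    by auto
  ultimately have "finite {x \<in> X. (\<lambda>x\<in>X. f (word_act w x)) x \<noteq> \<one>}"
    by (rule finite_subset[rotated])
  then show ?thesis
    using assms by auto
qed

lemma base_mult:
  assumes "f \<in> base" "f' \<in> base"
  shows "(\<lambda>x\<in>X. f x \<otimes> f' x) \<in> base"
proof -
  have "{x \<in> X. (\<lambda>x\<in>X. f x \<otimes> f' x) x \<noteq> \<one>} \<subseteq> {x \<in> X. f x \<noteq> \<one>} \<union> {x \<in> X. f' x \<noteq> \<one>}"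
    by auto
  moreover have "finite ({x \<in> X. f x \<noteq> \<one>} \<union> {x \<in> X. f' x \<noteq> \<one>})"
    using assms by auto
  ultimately have "finite {x \<in> X. (\<lambda>x\<in>X. f x \<otimes> f' x) x \<noteq> \<one>}"
    by (rule finite_subset)
  then show ?thesis
    using assms by auto
qed

lemma carrierI: "f \<in> base \<Longrightarrow> (f, word_act w) \<in> carrier W"
  unfolding carrier_W by blast

lemma restrict_eq_base:
  assumes "f \<in> base" "\<And>x. x \<in> X \<Longrightarrow> f' x = f x"
  shows "(\<lambda>x\<in>X. f' x) = f"
proof
  fix x
  show "(\<lambda>x\<in>X. f' x) x = f x"
  proof (cases "x \<in> X")
    case True
    then show ?thesis
      using assms(2)[OF True] by simp
  next
    case False
    then show ?thesis
      using PiE_arb[of f X "\<lambda>_. carrier G" x] assms(1) by simp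
  qed
qed

lemma group_W: "group W"
proof (rule groupI)
  fix a b assume a: "a \<in> carrier W" and b: "b \<in> carrier W"
  obtain f w where a_eq: "a = (f, word_act w)" and f: "f \<in> base"
    using a unfolding carrier_W by blast
  obtain f' w' where b_eq: "b = (f', word_act w')" and f': "f' \<in> base"
    using b unfolding carrier_W by blast
  have eq: "(\<lambda>x\<in>X. f x \<otimes> (\<lambda>x\<in>X. f' (word_act w x)) x) = (\<lambda>x\<in>X. f x \<otimes> f' (word_act w x))"
    by (rule restrict_ext) simp
  have "(\<lambda>x\<in>X. f x \<otimes> f' (word_act w x)) \<in> base"
    using base_mult[OF f base_translate[OF f', of w]] unfolding eq .
  from carrierI[OF this, of "w @ w'"] show "a \<otimes>\<^bsub>W\<^esub> b \<in> carrier W"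
    unfolding a_eq b_eq mult_W word_act_append .
  fix c assume c: "c \<in> carrier W"
  obtain f'' w'' where c_eq: "c = (f'', word_act w'')" and f'': "f'' \<in> base"
    using c unfolding carrier_W by blast
  show "a \<otimes>\<^bsub>W\<^esub> b \<otimes>\<^bsub>W\<^esub> c = a \<otimes>\<^bsub>W\<^esub> (b \<otimes>\<^bsub>W\<^esub> c)"
    unfolding a_eq b_eq c_eq mult_W
    using base_closed[OF f] base_closed[OF f'] base_closed[OF f'']
    by (auto simp: m_assoc intro!: restrict_ext)
next
  have "(\<lambda>x\<in>X. \<one>) \<in> base"
    by auto
  from carrierI[OF this, of "[]"] show "\<one>\<^bsub>W\<^esub> \<in> carrier W"
    unfolding one_W word_act.simps .
next
  fix a assume a: "a \<in> carrier W"
  obtain f w where a_eq: "a = (f, word_act w)" and f: "f \<in> base"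
    using a unfolding carrier_W by blast
  show "\<one>\<^bsub>W\<^esub> \<otimes>\<^bsub>W\<^esub> a = a"
    unfolding a_eq one_W mult_W using base_closed[OF f] by (auto intro!: restrict_eq_base[OF f])
  \<comment> \<open>The first coordinate of the product with \<open>a\<close> is
    \<open>f' x \<otimes> f (word_act (rev w) x)\<close>, and this choice makes it trivial.\<close>
  define f' where "f' = (\<lambda>x\<in>X. inv (f (word_act (rev w) x)))"
  have tr: "(\<lambda>x\<in>X. f (word_act (rev w) x)) \<in> base"
    using f by (rule base_translate)
  have "{x \<in> X. f' x \<noteq> \<one>} \<subseteq> {x \<in> X. (\<lambda>x\<in>X. f (word_act (rev w) x)) x \<noteq> \<one>}"
    by (auto simp: f'_def)
  then have "finite {x \<in> X. f' x \<noteq> \<one>}"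
    using tr by (auto intro: finite_subset)
  then have "f' \<in> base"
    using base_closed[OF f] by (auto simp: f'_def)
  then have "(f', word_act (rev w)) \<in> carrier W"
    by (rule carrierI)
  moreover have "(f', word_act (rev w)) \<otimes>\<^bsub>W\<^esub> a = \<one>\<^bsub>W\<^esub>"
    unfolding a_eq mult_W one_W using base_closed[OF f]
    by (auto simp: f'_def fun_eq_iff word_act_rev' intro!: restrict_ext)
  ultimately show "\<exists>b\<in>carrier W. b \<otimes>\<^bsub>W\<^esub> a = \<one>\<^bsub>W\<^esub>"
    by blast
qed

section \<open>Lamps and lifts of Grigorchuk elements\<close>

definition lamp :: "bool stream \<Rightarrow> 'a \<Rightarrow> (bool stream \<Rightarrow> 'a) \<times> (bool stream \<Rightarrow> bool stream)" where
  "lamp y g = (\<lambda>x\<in>X. if x = y then g else \<one>, id)"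

definition lift :: "(bool stream \<Rightarrow> bool stream) \<Rightarrow> (bool stream \<Rightarrow> 'a) \<times> (bool stream \<Rightarrow> bool stream)" where
  "lift h = (\<lambda>x\<in>X. \<one>, h)"

lemma lamp_carrier [simp]: "g \<in> carrier G \<Longrightarrow> lamp y g \<in> carrier W"
proof -
  assume g: "g \<in> carrier G"
  have "finite {x \<in> X. (\<lambda>x\<in>X. if x = y then g else \<one>) x \<noteq> \<one>}"
    by (rule finite_subset[of _ "{y}"]) auto
  then show ?thesis
    using g carrierI[of "\<lambda>x\<in>X. if x = y then g else \<one>" "[]"] unfolding lamp_def by auto
qed

lemma lift_carrier [simp]: "lift (word_act w) \<in> carrier W"
  unfolding lift_def by (rule carrierI) auto

lemma lift_letter_carrier [simp]: "lift (letter_act s) \<in> carrier W"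
  using lift_carrier[of "[s]"] by simp

lemma lift_mult:
  assumes "f \<in> base"
  shows "lift (word_act w) \<otimes>\<^bsub>W\<^esub> (f, h) = (\<lambda>x\<in>X. f (word_act w x), h \<circ> word_act w)"
  using base_closed[OF assms] unfolding lift_def by (auto intro!: restrict_ext)

lemma lamp_mult:
  assumes "f \<in> base"
  shows "lamp y g \<otimes>\<^bsub>W\<^esub> (f, h) = (\<lambda>x\<in>X. if x = y then g \<otimes> f x else f x, h)"
  using base_closed[OF assms] unfolding lamp_def by (auto intro!: restrict_ext)

lemma lamp_lamp: "g \<in> carrier G \<Longrightarrow> g' \<in> carrier G \<Longrightarrow> lamp y g \<otimes>\<^bsub>W\<^esub> lamp y g' = lamp y (g \<otimes> g')"
  unfolding lamp_def by (auto intro!: restrict_ext)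

lemma lamp_one: "lamp y \<one> = \<one>\<^bsub>W\<^esub>"
  unfolding lamp_def by (auto intro!: restrict_ext)

lemma inv_lamp: "g \<in> carrier G \<Longrightarrow> inv\<^bsub>W\<^esub> lamp y g = lamp y (inv g)"
  by (rule group.inv_equality[OF group_W]) (simp_all add: lamp_lamp lamp_one)

lemma lift_lift: "lift (word_act u) \<otimes>\<^bsub>W\<^esub> lift (word_act w) = lift (word_act (u @ w))"
  unfolding lift_def by (auto intro!: restrict_ext)

lemma inv_lift_letter: "inv\<^bsub>W\<^esub> lift (letter_act s) = lift (letter_act s)"
proof (rule group.inv_equality[OF group_W])
  show "lift (letter_act s) \<otimes>\<^bsub>W\<^esub> lift (letter_act s) = \<one>\<^bsub>W\<^esub>"
    by (auto simp: lift_def fun_eq_iff)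
qed simp_all

text \<open>Conjugation carries a lamp along the orbit; therefore one base point per generator of
  \<open>G\<close> suffices to generate.\<close>

lemma lamp_conjugate:
  assumes "g \<in> carrier G" "y \<in> X"
  shows "lift (word_act w) \<otimes>\<^bsub>W\<^esub> lamp (word_act w y) g \<otimes>\<^bsub>W\<^esub> lift (word_act (rev w)) = lamp y g"
  using assms inj_eq[OF inj_word_act, of w]
  unfolding lamp_def lift_def by (auto simp: fun_eq_iff word_act_rev)

text \<open>The map \<open>p\<close> is left free: separated base points give small growth, whereas
  a constant \<open>p\<close> exhibits a copy of \<open>G\<close> with its generators.\<close>

definition wreath_gens :: "('a \<Rightarrow> bool stream) \<Rightarrow> 'a set \<Rightarrow> ((bool stream \<Rightarrow> 'a) \<times> (bool stream \<Rightarrow> bool stream)) set" where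
  "wreath_gens p S = range (\<lambda>s. lift (letter_act s)) \<union> (\<lambda>s. lamp (p s) s) ` S"

lemma wreath_gens_carrier: "S \<subseteq> carrier G \<Longrightarrow> wreath_gens p S \<subseteq> carrier W"
  unfolding wreath_gens_def by auto

lemma finite_wreath_gens: "finite S \<Longrightarrow> finite (wreath_gens p S)"
  unfolding wreath_gens_def by simp

text \<open>Transitivity and conjugation place each generator of \<open>G\<close> at every point,
  hence all of \<open>G\<close> there. A finitely supported function is a product of such lamps, and
  the lifts supply the second coordinate.\<close>

lemma finite_generating_wreath_gens:
  assumes S: "finite_generating_set G S" and p: "\<And>s. s \<in> S \<Longrightarrow> p s \<in> X"
  shows "finite_generating_set W (wreath_gens p S)"
proof -
  have fin: "finite S" and sub: "S \<subseteq> carrier G" and gen: "generate G S = carrier G"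
    using S by (auto simp: finite_generating_set_def)
  let ?H = "generate W (wreath_gens p S)"
  have H: "subgroup ?H W"
    using group.generate_is_subgroup[OF group_W wreath_gens_carrier[OF sub]] .
  note mult_H = subgroup.m_closed[OF H]
  have letter_H: "lift (letter_act s) \<in> ?H" for s
    by (rule generate.incl) (simp add: wreath_gens_def)
  have lift_H: "lift (word_act w) \<in> ?H" for w
  proof (induction w)
    case Nil
    show ?case
      using subgroup.one_closed[OF H] by (simp add: lift_def id_def)
  next
    case (Cons s w)
    then show ?case
      using mult_H[OF letter_H[of s] Cons] lift_lift[of "[s]" w] by (simp add: comp_def)
  qed
  have lamp_gen: "lamp y s \<in> ?H" if s: "s \<in> S" and y: "y \<in> X" for y s
  proof -
    have lamp_p: "lamp (p s) s \<in> ?H"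
      using s by (intro generate.incl) (simp add: wreath_gens_def)
    obtain w where "p s = word_act w y"
      using orbit_transitive[OF y p[OF s]] by blast
    then have "lamp y s = lift (word_act w) \<otimes>\<^bsub>W\<^esub> lamp (p s) s \<otimes>\<^bsub>W\<^esub> lift (word_act (rev w))"
      using lamp_conjugate[of s y w] s y sub by auto
    then show ?thesis
      using mult_H[OF mult_H[OF lift_H lamp_p] lift_H] by simp
  qed
  have lamp_H: "lamp y g \<in> ?H" if "g \<in> carrier G" "y \<in> X" for y g
  proof -
    have "g \<in> generate G S"
      using that gen by simp
    then show ?thesis
    proof (induction rule: generate.induct)
      case one
      then show ?case
        using subgroup.one_closed[OF H] by (simp add: lamp_one)
    next
      case (incl h)
      then show ?case
        using lamp_gen that by blast
    next
      case (inv h)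
      then show ?case
        using subgroup.m_inv_closed[OF H lamp_gen[OF inv that(2)]] inv_lamp[of h y] sub by auto
    next
      case (eng h1 h2)
      then have "h1 \<in> carrier G" "h2 \<in> carrier G"
        using gen by auto
      then show ?case
        using mult_H[OF eng(3,4)] lamp_lamp by simp
    qed
  qed
  \<comment> \<open>Induction on a finite set containing the support, switching off one lamp at a
    time.\<close>
  have base_H: "f \<in> base \<Longrightarrow> {x \<in> X. f x \<noteq> \<one>} \<subseteq> A \<Longrightarrow> (f, id) \<in> ?H" if "finite A" for A f
    using that
  proof (induction A arbitrary: f rule: finite_induct)
    case empty
    then have "(\<lambda>x\<in>X. \<one>) = f"
      by (intro restrict_eq_base) auto
    then show ?case
      using subgroup.one_closed[OF H] unfolding one_W by (simp only:)
  next
    case (insert y A)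
    show ?case
    proof (cases "y \<in> X")
      case False
      then show ?thesis
        using insert.prems by (intro insert.IH) auto
    next
      case True
      define f' where "f' = (\<lambda>x\<in>X. if x = y then \<one> else f x)"
      have sub: "{x \<in> X. f' x \<noteq> \<one>} \<subseteq> {x \<in> X. f x \<noteq> \<one>} \<inter> A"
        using insert.prems by (auto simp: f'_def)
      have "finite {x \<in> X. f' x \<noteq> \<one>}"
        by (rule finite_subset[OF sub]) (use insert.hyps in simp)
      then have f': "f' \<in> base"
        using base_closed[OF insert.prems(1)] by (auto simp: f'_def)
      have "(f', id) \<in> ?H"
        using insert.IH[OF f'] sub by blast
      moreover have "lamp y (f y) \<in> ?H"
        using lamp_H base_closed[OF insert.prems(1) True] True by blast
      ultimately have "lamp y (f y) \<otimes>\<^bsub>W\<^esub> (f', id) \<in> ?H"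
        using mult_H by blast
      moreover have "lamp y (f y) \<otimes>\<^bsub>W\<^esub> (f', id) = (f, id)"
        unfolding lamp_mult[OF f'] using base_closed[OF insert.prems(1)]
        by (auto simp: f'_def intro!: restrict_eq_base[OF insert.prems(1)])
      ultimately show ?thesis
        by (simp only:)
    qed
  qed
  have "carrier W \<subseteq> ?H"
  proof
    fix a assume "a \<in> carrier W"
    then obtain f w where a: "a = (f, word_act w)" and f: "f \<in> base"
      unfolding carrier_W by blast
    have "(f, id) \<otimes>\<^bsub>W\<^esub> lift (word_act w) \<in> ?H"
      using f by (intro mult_H lift_H base_H[of "{x \<in> X. f x \<noteq> \<one>}"]) auto
    moreover have "(f, id) \<otimes>\<^bsub>W\<^esub> lift (word_act w) = a"
      unfolding a lift_def mult_W using base_closed[OF f] by (auto intro!: restrict_eq_base[OF f])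
    ultimately show "a \<in> ?H"
      by (simp only:)
  qed
  then have "?H = carrier W"
    using subgroup.subset[OF H] by blast
  then show ?thesis
    unfolding finite_generating_set_def
    using finite_wreath_gens[OF fin] wreath_gens_carrier[OF sub] by simp
qed

section \<open>Comparing balls with configurations\<close>

text \<open>Multiply from the right. A lift moves all lamps and prolongs both \<open>w\<close> and
  the paths \<open>u\<close>; a lamp generator alters only the value at its base point. The path
  \<open>u\<close> records from which base point a value stems, so that separation keeps powers of
  different generators apart.\<close>

lemma word_in_wreath:
  assumes S: "S \<subseteq> carrier G"
    and sep: "separated p S R"
  shows "set \<omega> \<subseteq> wreath_gens p S \<union> m_inv W ` wreath_gens p S \<Longrightarrow> length \<omega> \<le> R \<Longrightarrow>
    \<exists>f w. foldr (mult W) \<omega> \<one>\<^bsub>W\<^esub> = (f, word_act w) \<and> f \<in> base \<and> length w \<le> length \<omega>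
      \<and> (\<forall>z\<in>X. f z \<noteq> \<one> \<longrightarrow> z \<in> inv_orbit w (p ` S) \<and>
          (\<exists>s\<in>S. \<exists>u. \<exists>e::int. length u \<le> length \<omega> \<and> z = word_act u (p s)
             \<and> f z = s [^] e \<and> \<bar>e\<bar> \<le> int (length \<omega>)))"
proof (induction \<omega>)
  case Nil
  have "(\<lambda>x\<in>X. \<one>) \<in> base"
    by auto
  then show ?case
    by (intro exI[of _ "\<lambda>x\<in>X. \<one>"] exI[of _ "[]"]) auto
next
  case (Cons a \<omega>)
  then obtain f w where fold: "foldr (mult W) \<omega> \<one>\<^bsub>W\<^esub> = (f, word_act w)" and f: "f \<in> base"
    and w: "length w \<le> length \<omega>"
    and orb: "\<And>z. z \<in> X \<Longrightarrow> f z \<noteq> \<one> \<Longrightarrow> z \<in> inv_orbit w (p ` S)"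
    and val: "\<And>z. z \<in> X \<Longrightarrow> f z \<noteq> \<one> \<Longrightarrow> \<exists>s\<in>S. \<exists>u. \<exists>e::int. length u \<le> length \<omega>
        \<and> z = word_act u (p s) \<and> f z = s [^] e \<and> \<bar>e\<bar> \<le> int (length \<omega>)"
    by auto
  have "(\<exists>s. a = lift (letter_act s)) \<or> (\<exists>s\<in>S. \<exists>d\<in>{1, -1 :: int}. a = lamp (p s) (s [^] d))"
  proof -
    consider "a \<in> wreath_gens p S" | b where "b \<in> wreath_gens p S" "a = inv\<^bsub>W\<^esub> b"
      using Cons.prems(1) by auto
    then show ?thesis
    proof cases
      case 1
      then show ?thesis
        using S unfolding wreath_gens_def by (force simp: int_pow_1)
    next
      case (2 b)
      then show ?thesis
        using S unfolding wreath_gens_def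
        by (force simp: inv_lift_letter inv_lamp int_pow_neg int_pow_1)
    qed
  qed
  then show ?case
  proof (elim disjE exE bexE)
    fix s assume a: "a = lift (letter_act s)"
    define f' where "f' = (\<lambda>x\<in>X. f (letter_act s x))"
    have fold': "foldr (mult W) (a # \<omega>) \<one>\<^bsub>W\<^esub> = (f', word_act (s # w))"
      using lift_mult[OF f, of "[s]" "word_act w"] fold by (simp add: a f'_def)
    have base': "f' \<in> base"
      using base_translate[OF f, of "[s]"] unfolding f'_def by simp
    have "z \<in> inv_orbit (s # w) (p ` S) \<and> (\<exists>t\<in>S. \<exists>u. \<exists>e::int. length u \<le> length (a # \<omega>)
        \<and> z = word_act u (p t) \<and> f' z = t [^] e \<and> \<bar>e\<bar> \<le> int (length (a # \<omega>)))"
      if z: "z \<in> X" "f' z \<noteq> \<one>" for z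
    proof -
      have z': "letter_act s z \<in> X" "f (letter_act s z) \<noteq> \<one>" "f' z = f (letter_act s z)"
        using z by (auto simp: f'_def)
      obtain t u e where t: "t \<in> S" "length u \<le> length \<omega>" "letter_act s z = word_act u (p t)"
          "f (letter_act s z) = t [^] (e::int)" "\<bar>e\<bar> \<le> int (length \<omega>)"
        using val[OF z'(1,2)] by blast
      have "z = letter_act s (letter_act s z)"
        by simp
      then have "z = word_act (u @ [s]) (p t)"
        unfolding t(3) by simp
      then have "\<exists>t\<in>S. \<exists>u. \<exists>e::int. length u \<le> length (a # \<omega>)
        \<and> z = word_act u (p t) \<and> f' z = t [^] e \<and> \<bar>e\<bar> \<le> int (length (a # \<omega>))"
        using t z'(3) by (intro bexI[of _ t] exI[of _ "u @ [s]"] exI[of _ e]) auto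
      moreover have "letter_act s (letter_act s z) \<in> letter_act s ` inv_orbit w (p ` S)"
        using orb[OF z'(1,2)] by (rule imageI)
      ultimately show ?thesis
        by simp
    qed
    then show ?thesis
      using fold' base' w by (intro exI[of _ f'] exI[of _ "s # w"]) auto
  next
    fix s d assume s: "s \<in> S" and d: "d \<in> {1, -1 :: int}" and a: "a = lamp (p s) (s [^] d)"
    define f' where "f' = (\<lambda>x\<in>X. if x = p s then s [^] d \<otimes> f x else f x)"
    have s_carrier: "s \<in> carrier G"
      using s S by blast
    have fold': "foldr (mult W) (a # \<omega>) \<one>\<^bsub>W\<^esub> = (f', word_act w)"
      using lamp_mult[OF f, of "p s" "s [^] d" "word_act w"] fold by (simp add: a f'_def)
    have base': "f' \<in> base"
    proof -
      have "{x \<in> X. f' x \<noteq> \<one>} \<subseteq> insert (p s) {x \<in> X. f x \<noteq> \<one>}"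
        by (auto simp: f'_def)
      moreover have "finite (insert (p s) {x \<in> X. f x \<noteq> \<one>})"
        using f by simp
      ultimately have "finite {x \<in> X. f' x \<noteq> \<one>}"
        by (rule finite_subset)
      then show ?thesis
        using base_closed[OF f] s_carrier by (auto simp: f'_def)
    qed
    have "z \<in> inv_orbit w (p ` S) \<and> (\<exists>t\<in>S. \<exists>u. \<exists>e::int. length u \<le> length (a # \<omega>)
        \<and> z = word_act u (p t) \<and> f' z = t [^] e \<and> \<bar>e\<bar> \<le> int (length (a # \<omega>)))"
      if z: "z \<in> X" "f' z \<noteq> \<one>" for z
    proof (cases "z = p s")
      case True
      \<comment> \<open>The value already present at \<open>p s\<close> is a power of the same
        \<open>s\<close>, so multiplying by \<open>s [^] d\<close> merely shifts the exponent by
        one.\<close>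
      have "\<exists>e::int. f z = s [^] e \<and> \<bar>e\<bar> \<le> int (length \<omega>)"
      proof (cases "f z = \<one>")
        case True
        then show ?thesis
          by (intro exI[of _ 0]) simp
      next
        case False
        then obtain t u e where t: "t \<in> S" "length u \<le> length \<omega>" "z = word_act u (p t)"
            "f z = t [^] (e::int)" "\<bar>e\<bar> \<le> int (length \<omega>)"
          using val[OF z(1)] by blast
        \<comment> \<open>A value stemming from \<open>p t\<close> has arrived at \<open>p s\<close>
          within \<open>R\<close> steps; comparing with the empty path forces
          \<open>t = s\<close>.\<close>
        have "word_act u (p t) = word_act [] (p s)"
          using t(3) \<open>z = p s\<close> by simp
        from separatedD[OF sep t(1) s this] have "t = s"
          using Cons.prems(2) t(2) by simp
        then show ?thesis
          using t by blast
      qed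
      then obtain e :: int where e: "f z = s [^] e" "\<bar>e\<bar> \<le> int (length \<omega>)"
        by blast
      have "f' z = s [^] (d + e)"
        using True z(1) e(1) s_carrier by (simp add: f'_def int_pow_mult)
      moreover have "\<bar>d + e\<bar> \<le> int (length (a # \<omega>))"
        using d e(2) by auto
      moreover have "z \<in> inv_orbit w (p ` S)"
        using True s subset_inv_orbit by blast
      ultimately show ?thesis
        using True s by (intro conjI bexI[of _ s] exI[of _ "[]"] exI[of _ "d + e"]) auto
    next
      case False
      then have z': "f' z = f z" "f z \<noteq> \<one>"
        using z by (auto simp: f'_def)
      obtain t u e where t: "t \<in> S" "length u \<le> length \<omega>" "z = word_act u (p t)"
          "f z = t [^] (e::int)" "\<bar>e\<bar> \<le> int (length \<omega>)"
        using val[OF z(1) z'(2)] by blast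
      then show ?thesis
        using orb[OF z(1) z'(2)] z'(1)
        by (intro conjI bexI[of _ t] exI[of _ u] exI[of _ e]) auto
    qed
    then show ?thesis
      using fold' base' w by (intro exI[of _ f'] exI[of _ w]) auto
  qed
qed

lemma word_weight_le: "word_weight w \<le> 6 * length w"
proof (induction w)
  case (Cons s w)
  have "letter_weight s \<le> 6"
    by (cases s; cases "the s") auto
  with Cons show ?case
    by simp
qed simp

text \<open>Ball elements inject into configurations: \<open>word_in_wreath\<close> controls
  supports and values, and the factor 6 is the largest letter weight.\<close>

lemma growth_function_wreath_gens_le:
  assumes S: "finite S" "S \<subseteq> carrier G"
    and sep: "separated p S R"
    and Q: "Q = insert \<one> ((\<lambda>(s, e::int). s [^] e) ` (S \<times> {- int R..int R}))"
  shows "growth_function W (wreath_gens p S) R \<le> card (configs \<one> Q (p ` S) (6 * R))"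
proof -
  \<comment> \<open>Elements of \<open>base\<close> are extensional, so replacing the values outside
    \<open>X\<close> by \<one> loses no information.\<close>
  define \<Psi> :: "(bool stream \<Rightarrow> 'a) \<times> (bool stream \<Rightarrow> bool stream) \<Rightarrow> _"
    where "\<Psi> = (\<lambda>(f, h). (h, \<lambda>x. if x \<in> X then f x else \<one>))"
  let ?B = "word_ball W (wreath_gens p S) R"
  have ball: "\<exists>f w. c = (f, word_act w) \<and> f \<in> base \<and> length w \<le> R
      \<and> (\<forall>z\<in>X. f z \<noteq> \<one> \<longrightarrow> z \<in> inv_orbit w (p ` S) \<and> f z \<in> Q)" if "c \<in> ?B" for c
  proof -
    obtain \<omega> where \<omega>: "c = foldr (mult W) \<omega> \<one>\<^bsub>W\<^esub>" "length \<omega> \<le> R"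
        "set \<omega> \<subseteq> wreath_gens p S \<union> m_inv W ` wreath_gens p S"
      using \<open>c \<in> ?B\<close> unfolding word_ball_def by blast
    obtain f w where f: "c = (f, word_act w)" "f \<in> base" "length w \<le> length \<omega>"
      and val: "\<And>z. z \<in> X \<Longrightarrow> f z \<noteq> \<one> \<Longrightarrow> z \<in> inv_orbit w (p ` S) \<and>
          (\<exists>s\<in>S. \<exists>u. \<exists>e::int. length u \<le> length \<omega> \<and> z = word_act u (p s)
             \<and> f z = s [^] e \<and> \<bar>e\<bar> \<le> int (length \<omega>))"
      using word_in_wreath[OF S(2) sep \<omega>(3,2)] \<omega>(1) by auto
    have "f z \<in> Q" if z: "z \<in> X" "f z \<noteq> \<one>" for z
    proof -
      obtain s e where "s \<in> S" "f z = s [^] (e::int)" "\<bar>e\<bar> \<le> int (length \<omega>)"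
        using val[OF z] by blast
      then have "(s, e) \<in> S \<times> {- int R..int R}" "f z = (\<lambda>(s, e). s [^] e) (s, e)"
        using \<omega>(2) by auto
      then show ?thesis
        unfolding Q by (intro insertI2) (rule image_eqI)
    qed
    then show ?thesis
      using f val \<omega>(2) by (intro exI[of _ f] exI[of _ w]) auto
  qed
  have "\<Psi> ` ?B \<subseteq> configs \<one> Q (p ` S) (6 * R)"
  proof
    fix y assume "y \<in> \<Psi> ` ?B"
    then obtain c where c: "c \<in> ?B" "y = \<Psi> c"
      by blast
    obtain f w where f: "c = (f, word_act w)" "length w \<le> R"
      and val: "\<And>z. z \<in> X \<Longrightarrow> f z \<noteq> \<one> \<Longrightarrow> z \<in> inv_orbit w (p ` S)"
        "\<And>z. z \<in> X \<Longrightarrow> f z \<noteq> \<one> \<Longrightarrow> f z \<in> Q"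
      using ball[OF c(1)] by auto
    let ?f = "\<lambda>x. if x \<in> X then f x else \<one>"
    have "y = (word_act w, ?f)"
      unfolding c(2) f(1) \<Psi>_def by simp
    moreover have "word_weight w \<le> 6 * R"
      using word_weight_le[of w] f(2) by simp
    moreover have "range ?f \<subseteq> Q"
    proof -
      have "\<one> \<in> Q"
        unfolding Q by (rule insertI1)
      then have "?f x \<in> Q" for x
        using val(2)[of x] by (cases "f x = \<one>") auto
      then show ?thesis
        by blast
    qed
    moreover have "p ` S \<subseteq> thicken (p ` S)"
      unfolding thicken_def by blast
    then have "inv_orbit w (p ` S) \<subseteq> inv_orbit w (thicken (p ` S))"
      by (rule inv_orbit_mono)
    then have "\<forall>x. x \<notin> inv_orbit w (thicken (p ` S)) \<longrightarrow> ?f x = \<one>"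
      using val(1) by auto
    ultimately show "y \<in> configs \<one> Q (p ` S) (6 * R)"
      unfolding configs_def by blast
  qed
  moreover have "inj_on \<Psi> ?B"
  proof (rule inj_onI)
    fix c c' assume c: "c \<in> ?B" "c' \<in> ?B" and eq: "\<Psi> c = \<Psi> c'"
    obtain f w where f: "c = (f, word_act w)" "f \<in> base"
      using ball[OF c(1)] by blast
    obtain f' w' where f': "c' = (f', word_act w')" "f' \<in> base"
      using ball[OF c(2)] by blast
    have h: "word_act w = word_act w'"
      and fun_eq: "(\<lambda>x. if x \<in> X then f x else \<one>) = (\<lambda>x. if x \<in> X then f' x else \<one>)"
      using eq unfolding f(1) f'(1) \<Psi>_def by simp_all
    have "(\<lambda>x\<in>X. f x) = f'"
      using fun_cong[OF fun_eq] by (intro restrict_eq_base[OF f'(2)]) (metis (full_types))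
    moreover have "(\<lambda>x\<in>X. f x) = f"
      by (rule restrict_eq_base[OF f(2)]) simp
    ultimately show "c = c'"
      unfolding f(1) f'(1) h by simp
  qed
  moreover have "finite (configs \<one> Q (p ` S) (6 * R))"
    using S(1) Q by (intro configs_trivial_bound(1)[OF _ order_refl]) auto
  ultimately show ?thesis
    unfolding growth_function_def by (meson card_inj_on_le)
qed

text \<open>The order of choices matters: \<open>S\<close> fixes \<open>k\<close>, then \<epsilon>
  determines \<open>m\<close> and the radius \<open>R\<close>, and only then are base points
  separated at scale \<open>R\<close> chosen. The ball of this one radius bounds the rate.\<close>

lemma small_growth_rate:
  assumes S: "finite_generating_set G S" and "0 < \<epsilon>"
  shows "\<exists>T. finite_generating_set W T \<and> growth_rate W T < 1 + \<epsilon>"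
proof -
  have fin: "finite S" and sub: "S \<subseteq> carrier G"
    using S by (auto simp: finite_generating_set_def)
  \<comment> \<open>The successor keeps \<open>k\<close> positive even when \<open>S\<close> is
    empty.\<close>
  define k where "k = Suc (card S)"
  define T where "T m = (1 / 2) ^ m * (2 * (ln 6 + ln (2 * 4 ^ m + 1)))
      + (6 * (6 / 7) ^ m + 6 * (1 / 2) ^ m) * (ln 4 + 5 * real k * (ln (2 * real k) + ln (2 * 4 ^ m + 1)))"
    for m :: nat
  have "(\<lambda>m. exp (T m)) \<longlonglongrightarrow> exp 0"
    unfolding T_def by (intro tendsto_exp growth_exponent_tendsto)
  then have "\<forall>\<^sub>F m in sequentially. exp (T m) < 1 + \<epsilon>"
    by (rule order_tendstoD(2)) (use \<open>0 < \<epsilon>\<close> in simp)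
  then have "\<forall>\<^sub>F m in sequentially. exp (T m) < 1 + \<epsilon> \<and> 2 \<le> m"
    using eventually_ge_at_top[of 2] by (rule eventually_conj)
  then obtain m where m: "exp (T m) < 1 + \<epsilon>" "2 \<le> m"
    using eventually_happens'[OF sequentially_bot] by blast
  define R :: nat where "R = 4 ^ m"
  obtain p where p: "\<forall>s\<in>S. p s \<in> X" and sep: "separated p S R"
    using separated_basepoints_exist[OF fin, of R] by blast
  define Q where "Q = insert \<one> ((\<lambda>(s, e::int). s [^] e) ` (S \<times> {- int R..int R}))"
  have "card Q \<le> Suc (card ((\<lambda>(s, e::int). s [^] e) ` (S \<times> {- int R..int R})))"
    unfolding Q_def by (rule card_insert_le_m1) simp_all
  also have "card ((\<lambda>(s, e::int). s [^] e) ` (S \<times> {- int R..int R})) \<le> card (S \<times> {- int R..int R})"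
    using fin by (intro card_image_le) simp
  also have "\<dots> = card S * (2 * R + 1)"
    by (simp add: card_cartesian_product nat_add_distrib nat_mult_distrib)
  also have "\<dots> \<le> k * (2 * R + 1)"
    by (intro mult_le_mono1) (simp add: k_def)
  finally have card_Q: "card Q \<le> k * (2 * 4 ^ m + 1) + 1"
    by (simp add: R_def)
  have Q: "finite Q" "Q \<noteq> {}"
    using fin by (simp_all add: Q_def)
  have gens: "finite_generating_set W (wreath_gens p S)"
    using finite_generating_wreath_gens[OF S] p by blast
  then have "growth_rate W (wreath_gens p S) \<le> root R (real (growth_function W (wreath_gens p S) R))"
    by (intro group.growth_rate_le[OF group_W]) (auto simp: finite_generating_set_def R_def)
  also have "\<dots> \<le> root R (real (card (configs \<one> Q (p ` S) (6 * R))))"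
    using growth_function_wreath_gens_le[OF fin sub sep Q_def]
    by (intro real_root_le_mono) (auto simp: R_def)
  also have "\<dots> \<le> exp (T m)"
    unfolding R_def T_def using fin card_image_le[OF fin, of p]
    by (intro root_card_configs_le Q card_Q m(2)) (auto simp: k_def)
  finally show ?thesis
    using gens m(1) by (intro exI[of _ "wreath_gens p S"]) simp
qed

text \<open>Lamps at one fixed point form a copy of \<open>G\<close> whose balls inject into those
  of the wreath product.\<close>

lemma exponential_growth_W:
  assumes "exponential_growth G"
  shows "exponential_growth W"
proof -
  obtain S where S: "finite_generating_set G S" and rate: "1 < growth_rate G S"
    using assms unfolding exponential_growth_def by blast
  have fin: "finite S" and sub: "S \<subseteq> carrier G"
    using S by (auto simp: finite_generating_set_def)
  define y where "y = sconst False"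
  have y: "y \<in> X"
    unfolding grigorchuk_orbit_eq y_def by (rule range_eqI[of _ _ "[]"]) simp
  define T where "T = wreath_gens (\<lambda>_. y) S"
  have gens: "finite_generating_set W T"
    unfolding T_def by (rule finite_generating_wreath_gens[OF S y])
  have "growth_function G S R \<le> growth_function W T R" for R
  proof -
    have "lamp y ` word_ball G S R \<subseteq> word_ball W T R"
    proof
      fix x assume "x \<in> lamp y ` word_ball G S R"
      then obtain \<omega> where \<omega>: "x = lamp y (foldr (mult G) \<omega> \<one>)" "set \<omega> \<subseteq> S \<union> m_inv G ` S" "length \<omega> \<le> R"
        unfolding word_ball_def by blast
      have "lamp y (foldr (mult G) \<omega> \<one>) = foldr (mult W) (map (lamp y) \<omega>) \<one>\<^bsub>W\<^esub>"
        using \<omega>(2)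
      proof (induction \<omega>)
        case Nil
        show ?case
          using lamp_one[of y] by simp
      next
        case (Cons a \<omega>)
        have "a \<in> carrier G" "foldr (mult G) \<omega> \<one> \<in> carrier G"
          using Cons.prems symmetrized_subset[OF sub] by (auto intro!: foldr_mult_closed)
        then show ?case
          using Cons by (simp flip: lamp_lamp)
      qed
      moreover have "lamp y a \<in> T \<union> m_inv W ` T" if a: "a \<in> S \<union> m_inv G ` S" for a
      proof -
        have in_T: "lamp y s \<in> T" if "s \<in> S" for s
          using that by (simp add: T_def wreath_gens_def)
        consider "a \<in> S" | s where "s \<in> S" "a = inv s"
          using a by blast
        then show ?thesis
        proof cases
          case 1
          then show ?thesis
            using in_T by blast
        next
          case (2 s)
          then have "lamp y a = inv\<^bsub>W\<^esub> lamp y s"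
            using inv_lamp[of s y] sub by auto
          then show ?thesis
            using in_T[OF 2(1)] by blast
        qed
      qed
      then have "set (map (lamp y) \<omega>) \<subseteq> T \<union> m_inv W ` T"
        unfolding set_map using \<omega>(2) by blast
      ultimately show "x \<in> word_ball W T R"
        unfolding \<omega>(1) using word_ballI[of "map (lamp y) \<omega>" T W R] \<omega>(3) by simp
    qed
    moreover have "inj_on (lamp y) (word_ball G S R)"
    proof (rule inj_onI)
      fix g g' assume "lamp y g = lamp y g'"
      then have "(\<lambda>x\<in>X. if x = y then g else \<one>) y = (\<lambda>x\<in>X. if x = y then g' else \<one>) y"
        unfolding lamp_def by simp
      then show "g = g'"
        using y by simp
    qed
    moreover have "finite (word_ball W T R)"
      using gens by (intro finite_word_ball) (simp add: finite_generating_set_def)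
    ultimately show ?thesis
      unfolding growth_function_def by (meson card_inj_on_le)
  qed
  then have "growth_rate G S \<le> growth_rate W T"
    using gens fin sub by (intro growth_rate_mono group_W is_group) (auto simp: finite_generating_set_def)
  then show ?thesis
    using gens rate unfolding exponential_growth_def by (meson less_le_trans)
qed

end

theorem corollary7p2:
  fixes G :: "('a, 'b) monoid_scheme"
  assumes "group G"
    and "finitely_generated G"
    and "exponential_growth G"
  shows "nonuniform_exponential_growth
    (perm_wreath_product G grigorchuk_orbit (\<lambda>x g. g x) grigorchuk_group)"
proof -
  interpret grigorchuk_wreath G
    using assms(1) by (simp add: grigorchuk_wreath_def)
  obtain S where S: "finite_generating_set G S"
    using assms(2) unfolding finitely_generated_def by blast
  let ?\<Lambda> = "growth_rate W ` {T. finite_generating_set W T}"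
  have exp: "exponential_growth W"
    using exponential_growth_W[OF assms(3)] .
  have ge: "1 \<le> r" if "r \<in> ?\<Lambda>" for r
    using that group.growth_rate_ge_1[OF group_W] by (auto simp: finite_generating_set_def)
  have "Inf ?\<Lambda> = 1"
  proof (rule antisym)
    show "Inf ?\<Lambda> \<le> 1"
    proof (rule field_le_epsilon)
      fix \<epsilon> :: real assume "0 < \<epsilon>"
      then obtain T where T: "finite_generating_set W T" "growth_rate W T < 1 + \<epsilon>"
        using small_growth_rate[OF S] by blast
      have "Inf ?\<Lambda> \<le> growth_rate W T"
        using T(1) ge by (intro cInf_lower bdd_belowI[of _ 1]) auto
      then show "Inf ?\<Lambda> \<le> 1 + \<epsilon>"
        using T(2) by simp
    qed
    \<comment> \<open>For this bound \<open>small_growth_rate\<close> supplies the nonemptiness of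
      the set of rates.\<close>
    show "1 \<le> Inf ?\<Lambda>"
      using small_growth_rate[OF S zero_less_one] ge by (intro cInf_greatest) auto
  qed
  then show ?thesis
    using exp unfolding nonuniform_exponential_growth_def W_def by blast
qed

end
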